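(* Let $A,B$ be countably infinite groups, $G=A\times B$, $G\curvearrowright(X,\mu)$ an essentially free ergodic probability-measure-preserving action on a standard probability space, and $\mathcal R\subset X\times X$ its orbit equivalence relation. If $B$ is non-amenable and $A$ contains an infinite amenable subgroup $A'\le A$, then $\mathcal R$ has higher rank, i.e. $\mathcal R$ does not have rank 1.
   Context: The orbit equivalence relation of an action $G\curvearrowright X$ is $\{(x,gx):x\in X,g\in G\}$. For a discrete (countable classes) Borel equivalence relation $\mathcal R$ on $(X,\mu)$ for which $\mu$ is $\mathcal R$-invariant (i.e. preserved by every Borel isomorphism of $X$ with graph in $\mathcal R$), let $\hat\mu(F)=\int|\{y:(x,y)\in F\}|\,d\mu(x)$ for $F\subset\mathcal R$. A subequivalence relation $\mathcal S\le\mathcal R$ is a Borel subset of $\mathcal R$ that is an equivalence relation on $X$; it is aperiodic if a.e. class is infinite; it is hyperfinite if there are Borel subequivalence relations $\mathcal S_1\le\mathcal S_2\le\cdots$ with all $\mathcal S_n$-classes finite and $\mathcal S=\bigcup_n\mathcal S_n$. All notions are understood up to null sets (subequivalence relations with $\hat\mu$-null symmetric difference are identified). A hyperfinite $\mathcal S\le\mathcal R$ is maximal hyperfinite if there is no hyperfinite $\mathcal S'\le\mathcal R$ with $\mathcal S\le\mathcal S'$ and $\hat\mu(\mathcal S'\setminus\mathcal S)>0$. $\mathcal R$ has rank 1 if every aperiodic hyperfinite subequivalence relation of $\mathcal R$ is contained in a unique (up to null sets) maximal hyperfinite subequivalence relation; it has higher rank if it does not have rank 1. *)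

theory Defs
  imports "HOL-Algebra.Group_Action" "HOL-Probability.Probability"
begin

section \<open>Amenability\<close>

definition amenable :: "('a, 'm) monoid_scheme \<Rightarrow> bool" where
  "amenable G \<longleftrightarrow>
     (\<exists>m :: 'a set \<Rightarrow> real.
        (\<forall>S. S \<subseteq> carrier G \<longrightarrow> 0 \<le> m S) \<and>
        m (carrier G) = 1 \<and>
        (\<forall>S T. S \<subseteq> carrier G \<longrightarrow> T \<subseteq> carrier G \<longrightarrow> S \<inter> T = {} \<longrightarrow> m (S \<union> T) = m S + m T) \<and>
        (\<forall>g\<in>carrier G. \<forall>S. S \<subseteq> carrier G \<longrightarrow> m (g <#\<^bsub>G\<^esub> S) = m S))"

section \<open>Standard probability spaces and actions on them\<close>

definition standard_borel_space :: "'x measure \<Rightarrow> bool" where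
  "standard_borel_space M \<longleftrightarrow>
     (\<exists>T. topspace T = space M \<and> completely_metrizable_space T \<and> second_countable T \<and>
          sets M = sigma_sets (space M) {U. openin T U})"

definition standard_prob_space :: "'x measure \<Rightarrow> bool" where
  "standard_prob_space M \<longleftrightarrow> standard_borel_space M \<and> prob_space M"

text \<open>The groups are discrete, so measurability of an action is measurability of each
  single transformation.\<close>

definition pmp_action :: "('g, 'm) monoid_scheme \<Rightarrow> 'x measure \<Rightarrow> ('g \<Rightarrow> 'x \<Rightarrow> 'x) \<Rightarrow> bool" where
  "pmp_action G M \<phi> \<longleftrightarrow>
     group_action G (space M) \<phi> \<and> prob_space M \<and>
     (\<forall>g\<in>carrier G. \<phi> g \<in> measurable M M \<and> distr M M (\<phi> g) = M)"

definition essentially_free :: "('g, 'm) monoid_scheme \<Rightarrow> 'x measure \<Rightarrow> ('g \<Rightarrow> 'x \<Rightarrow> 'x) \<Rightarrow> bool" where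
  "essentially_free G M \<phi> \<longleftrightarrow> (AE x in M. stabilizer G \<phi> x = {\<one>\<^bsub>G\<^esub>})"

definition ergodic_action :: "('g, 'm) monoid_scheme \<Rightarrow> 'x measure \<Rightarrow> ('g \<Rightarrow> 'x \<Rightarrow> 'x) \<Rightarrow> bool" where
  "ergodic_action G M \<phi> \<longleftrightarrow>
     (\<forall>E\<in>sets M. (\<forall>g\<in>carrier G. \<phi> g ` E = E) \<longrightarrow>
        emeasure M E = 0 \<or> emeasure M (space M - E) = 0)"

definition orbit_rel :: "('g, 'm) monoid_scheme \<Rightarrow> 'x measure \<Rightarrow> ('g \<Rightarrow> 'x \<Rightarrow> 'x) \<Rightarrow> 'x rel" where
  "orbit_rel G M \<phi> = {(x, \<phi> g x) | x g. x \<in> space M \<and> g \<in> carrier G}"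

section \<open>Subequivalence relations and rank\<close>

text \<open>The measure \<open>\<mu>\<close>-hat on the relation. It is only applied to measurable sets with countable sections
  over a standard Borel space, for which the integrand is measurable.\<close>

definition rel_measure :: "'x measure \<Rightarrow> 'x rel \<Rightarrow> ennreal" where
  "rel_measure M F = (\<integral>\<^sup>+ x. emeasure (count_space UNIV) (F `` {x}) \<partial>M)"

definition subset_mod_null :: "'x measure \<Rightarrow> 'x rel \<Rightarrow> 'x rel \<Rightarrow> bool" where
  "subset_mod_null M S T \<longleftrightarrow> rel_measure M (S - T) = 0"

definition eq_mod_null :: "'x measure \<Rightarrow> 'x rel \<Rightarrow> 'x rel \<Rightarrow> bool" where
  "eq_mod_null M S T \<longleftrightarrow> rel_measure M ((S - T) \<union> (T - S)) = 0"

definition subequiv_rel :: "'x measure \<Rightarrow> 'x rel \<Rightarrow> 'x rel \<Rightarrow> bool" where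
  "subequiv_rel M R S \<longleftrightarrow> S \<in> sets (M \<Otimes>\<^sub>M M) \<and> S \<subseteq> R \<and> equiv (space M) S"

definition aperiodic :: "'x measure \<Rightarrow> 'x rel \<Rightarrow> bool" where
  "aperiodic M S \<longleftrightarrow> (AE x in M. infinite (S `` {x}))"

text \<open>The \<open>T n\<close> exhaust \<open>S\<close> up to a null set. Taking them inside \<open>S\<close> is no restriction:
  otherwise replace \<open>T n\<close> by \<open>T n \<inter> S\<close>.\<close>

definition hyperfinite :: "'x measure \<Rightarrow> 'x rel \<Rightarrow> bool" where
  "hyperfinite M S \<longleftrightarrow>
     (\<exists>T :: nat \<Rightarrow> 'x rel. incseq T \<and>
        (\<forall>n. subequiv_rel M S (T n) \<and> (\<forall>x\<in>space M. finite (T n `` {x}))) \<and>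
        eq_mod_null M S (\<Union>n. T n))"

definition maximal_hyperfinite :: "'x measure \<Rightarrow> 'x rel \<Rightarrow> 'x rel \<Rightarrow> bool" where
  "maximal_hyperfinite M R S \<longleftrightarrow>
     subequiv_rel M R S \<and> hyperfinite M S \<and>
     \<not> (\<exists>S'. subequiv_rel M R S' \<and> hyperfinite M S' \<and>
            subset_mod_null M S S' \<and> rel_measure M (S' - S) > 0)"

definition rank_one :: "'x measure \<Rightarrow> 'x rel \<Rightarrow> bool" where
  "rank_one M R \<longleftrightarrow>
     (\<forall>S. subequiv_rel M R S \<longrightarrow> aperiodic M S \<longrightarrow> hyperfinite M S \<longrightarrow>
        (\<exists>T. maximal_hyperfinite M R T \<and> subset_mod_null M S T \<and>
             (\<forall>T'. maximal_hyperfinite M R T' \<longrightarrow> subset_mod_null M S T' \<longrightarrow>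
                   eq_mod_null M T T')))"

definition higher_rank :: "'x measure \<Rightarrow> 'x rel \<Rightarrow> bool" where
  "higher_rank M R \<longleftrightarrow> \<not> rank_one M R"

end

theory Submission
  imports Defs "HOL-Algebra.Generated_Groups"
begin

text \<open>
  Suppose that the orbit relation \<open>R\<close> has rank 1. For \<open>b \<in> B\<close> let \<open>S b\<close> be the orbit relation of the subgroup
  \<open>A' \<times> \<langle>b\<rangle>\<close>, which is a direct product because the two factors commute. This subgroup is infinite and satisfies
  the Folner condition, so \<open>S b\<close> is aperiodic and, by the Ornstein-Weiss theorem
  (\<open>hyperfinite_orbit_rel\<close>), hyperfinite. Hence \<open>S b\<close> lies in a maximal hyperfinite relation \<open>T b\<close>. All of these contain
  the aperiodic hyperfinite relation \<open>S \<one>\<close> of \<open>A'\<close>, so by uniqueness for \<open>S \<one>\<close> they coincide up to null sets with a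
  single relation \<open>T\<close>. This \<open>T\<close> contains the graph of every \<open>b \<in> B\<close>. But a group whose free measure-preserving
  action has its orbits inside a hyperfinite relation is amenable (\<open>amenable_if_orbits_in_hyperfinite\<close>), a contradiction.

  The Ornstein-Weiss theorem rests on two observations. First, amenability in the form of an invariant mean yields Folner
  sets (\<open>amenable_imp_folner\<close>): otherwise a finite set doubles all finite sets, and Hall's marriage theorem turns this into a
  paradoxical decomposition. Folner sets for \<open>A' \<times> \<langle>b\<rangle>\<close> are then products. Second, inside any set \<open>Y\<close> of positive measure one
  can tile a part of positive measure by finite pieces of orbits with relatively small boundary in \<open>Y\<close>
  (\<open>exists_tiling_with_small_cut\<close>), by intersecting translates of a Folner set, chosen depending on \<open>Y\<close>, with \<open>Y\<close>; exhausting the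
  space by such tilings approximates the orbit relation by finite relations.
\<close>

section \<open>Hall's marriage theorem\<close>

definition hall_condition :: "'i set \<Rightarrow> ('i \<Rightarrow> 'b set) \<Rightarrow> bool" where
  "hall_condition I A \<longleftrightarrow> (\<forall>J. J \<subseteq> I \<longrightarrow> finite J \<longrightarrow> card J \<le> card (\<Union> (A ` J)))"

text \<open>Rado's step. If both deletions violated Hall's condition, the two violating index sets \<open>J\<close> and \<open>K\<close>
  would cover, together with the two halves of \<open>A i\<close>, at most \<open>card J + card K\<close> points counted by
  union and intersection. The union contains all of \<open>A i\<close>, so Hall's condition for
  \<open>insert i (J \<union> K)\<close> and for \<open>J \<inter> K\<close> demands one point more.\<close>

lemma hall_condition_remove_point:
  assumes fin: "\<And>i. i \<in> I \<Longrightarrow> finite (A i)" and hall: "hall_condition I A"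
    and i: "i \<in> I" and xy: "x \<noteq> y"
  shows "hall_condition I (A(i := A i - {x})) \<or> hall_condition I (A(i := A i - {y}))"
proof (rule ccontr)
  let ?U = "\<lambda>J. \<Union> (A ` J)"
  have bad: "\<exists>J. J \<subseteq> I - {i} \<and> finite J \<and> card (?U J \<union> (A i - {z})) \<le> card J"
    if not_hall: "\<not> hall_condition I (A(i := A i - {z}))" for z
  proof -
    obtain J where J: "J \<subseteq> I" "finite J" "\<not> card J \<le> card (\<Union> ((A(i := A i - {z})) ` J))"
      using not_hall unfolding hall_condition_def by blast
    have "i \<in> J"
    proof (rule ccontr)
      assume "i \<notin> J"
      then have "(A(i := A i - {z})) ` J = A ` J" by (intro image_cong) auto
      with J hall show False unfolding hall_condition_def by metis
    qed
    have "\<Union> ((A(i := A i - {z})) ` J) = ?U (J - {i}) \<union> (A i - {z})"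
      using \<open>i \<in> J\<close> by auto
    moreover have "card J = Suc (card (J - {i}))"
      using J \<open>i \<in> J\<close> by (metis card.remove)
    ultimately have le: "card (?U (J - {i}) \<union> (A i - {z})) \<le> card (J - {i})"
      using J(3) by simp
    show ?thesis
      by (rule exI[of _ "J - {i}"], intro conjI le) (use J(1,2) in auto)
  qed
  assume "\<not> ?thesis"
  then obtain J K where J: "J \<subseteq> I - {i}" "finite J" "card (?U J \<union> (A i - {x})) \<le> card J"
    and K: "K \<subseteq> I - {i}" "finite K" "card (?U K \<union> (A i - {y})) \<le> card K"
    using bad[of x] bad[of y] by blast
  let ?P = "?U J \<union> (A i - {x})" and ?Q = "?U K \<union> (A i - {y})"
  have finP: "finite ?P" using J fin i by auto
  have finQ: "finite ?Q" using K fin i by auto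
  have "card (insert i (J \<union> K)) \<le> card (?U (insert i (J \<union> K)))"
    using hall J(1,2) K(1,2) i unfolding hall_condition_def by (metis Diff_subset Un_least finite.insertI finite_Un insert_subset order_trans)
  also have "?U (insert i (J \<union> K)) = ?P \<union> ?Q" using xy by auto
  finally have un: "Suc (card (J \<union> K)) \<le> card (?P \<union> ?Q)"
    using J K by (subst (asm) card_insert_disjoint) auto
  have "card (J \<inter> K) \<le> card (?U (J \<inter> K))"
    using hall J K unfolding hall_condition_def by blast
  also have "\<dots> \<le> card (?P \<inter> ?Q)"
    using finP by (intro card_mono) auto
  finally have int: "card (J \<inter> K) \<le> card (?P \<inter> ?Q)" .
  have "card ?P + card ?Q = card (?P \<union> ?Q) + card (?P \<inter> ?Q)"
    using finP finQ by (rule card_Un_Int)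
  moreover have "card J + card K = card (J \<union> K) + card (J \<inter> K)"
    using J K by (intro card_Un_Int)
  ultimately show False using un int J(3) K(3) by linarith
qed

text \<open>A subfamily that is minimal among those satisfying Hall's condition consists of singletons, since
  otherwise a point could be removed; singletons satisfying Hall's condition are distinct and
  form the matching. Finiteness of the sets makes Hall's condition pass to the intersection of a chain of
  subfamilies, whatever the size of the index set.\<close>

theorem hall_marriage:
  assumes fin: "\<And>i. i \<in> I \<Longrightarrow> finite (A i)" and hall: "hall_condition I A"
  shows "\<exists>f. (\<forall>i\<in>I. f i \<in> A i) \<and> inj_on f I"
proof -
  define \<F> where "\<F> = {Z. Z \<inter> - Sigma I A = {} \<and> hall_condition I (\<lambda>i. Z `` {i})}"
  \<comment> \<open>Zorn's lemma is stated for unions, so it is applied to the complements.\<close>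
  have "\<exists>W\<in>uminus ` \<F>. \<forall>X\<in>uminus ` \<F>. W \<subseteq> X \<longrightarrow> X = W"
  proof (rule subset_Zorn_nonempty)
    have "(\<lambda>i. Sigma I A `` {i}) ` J = A ` J" if "J \<subseteq> I" for J
      using that by (intro image_cong) auto
    then have "Sigma I A \<in> \<F>"
      using hall unfolding \<F>_def hall_condition_def by auto
    then show "uminus ` \<F> \<noteq> {}" by blast
  next
    fix \<C> assume ne: "\<C> \<noteq> {}" and chain: "subset.chain (uminus ` \<F>) \<C>"
    let ?N = "- \<Union> \<C>"
    have sub: "?N \<subseteq> Sigma I A"
    proof -
      obtain c where "c \<in> \<C>" using ne by blast
      then have "- c \<in> \<F>" using chain unfolding subset.chain_def by auto
      then show ?thesis using \<open>c \<in> \<C>\<close> unfolding \<F>_def by blast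
    qed
    have "card J \<le> card (\<Union>i\<in>J. ?N `` {i})" if J: "J \<subseteq> I" "finite J" for J
    proof -
      let ?R = "\<Union> \<C> \<inter> Sigma J A"
      have "finite ?R" using J fin by (intro finite_Int disjI2 finite_SigmaI) auto
      \<comment> \<open>The finitely many points deleted over \<open>J\<close> are already deleted by one member of the chain.\<close>
      then obtain c where c: "c \<in> \<C>" "?R \<subseteq> c"
        using finite_subset_Union_chain[of ?R \<C> "uminus ` \<F>"] ne chain by (metis Int_lower1)
      have cF: "- c \<in> \<F>" using chain c unfolding subset.chain_def by auto
      then have "card J \<le> card (\<Union>i\<in>J. (- c) `` {i})"
        using J unfolding \<F>_def hall_condition_def by blast
      also have "(\<Union>i\<in>J. (- c) `` {i}) = (\<Union>i\<in>J. ?N `` {i})"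
        using c cF unfolding \<F>_def by auto
      finally show ?thesis .
    qed
    then have "?N \<in> \<F>" using sub unfolding \<F>_def hall_condition_def by auto
    then show "\<Union> \<C> \<in> uminus ` \<F>" by (rule image_eqI[rotated]) simp
  qed
  then obtain W where W: "W \<in> \<F>" and max: "\<forall>X\<in>uminus ` \<F>. - W \<subseteq> X \<longrightarrow> X = - W" by blast
  then have minimal: "Z = W" if "Z \<in> \<F>" "Z \<subseteq> W" for Z
  proof -
    have "- Z \<in> uminus ` \<F>" "- W \<subseteq> - Z" using that by auto
    then have "- Z = - W" using max by blast
    then show ?thesis by simp
  qed
  have WS: "W \<subseteq> Sigma I A" and hallW: "hall_condition I (\<lambda>i. W `` {i})"
    using W unfolding \<F>_def by auto
  have finW: "finite (W `` {i})" if "i \<in> I" for i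
    using WS fin[OF that] by (auto intro: finite_subset[of _ "A i"])
  have unique: "x = y" if i: "i \<in> I" "(i, x) \<in> W" "(i, y) \<in> W" for i x y
  proof (rule ccontr)
    assume "x \<noteq> y"
    then obtain z where z: "z \<in> {x, y}" "hall_condition I ((\<lambda>i. W `` {i})(i := W `` {i} - {z}))"
      using hall_condition_remove_point[of I "\<lambda>i. W `` {i}" i x y] finW hallW i by blast
    have "(\<lambda>i. W `` {i})(i := W `` {i} - {z}) = (\<lambda>j. (W - {(i, z)}) `` {j})"
      by (rule ext) auto
    then have "W - {(i, z)} \<in> \<F>" using z WS unfolding \<F>_def by auto
    then show False using minimal[of "W - {(i, z)}"] z i by auto
  qed
  have "\<exists>x. (i, x) \<in> W" if "i \<in> I" for i
  proof -
    have "card {i} \<le> card (W `` {i})"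
      using hallW[unfolded hall_condition_def, rule_format, of "{i}"] that by auto
    then have "W `` {i} \<noteq> {}" by auto
    then show ?thesis by auto
  qed
  then obtain f where f: "\<And>i. i \<in> I \<Longrightarrow> (i, f i) \<in> W" by metis
  have "inj_on f I"
  proof (rule inj_onI, rule ccontr)
    fix i j assume ij: "i \<in> I" "j \<in> I" "f i = f j" "i \<noteq> j"
    have "W `` {i} = {f i}" "W `` {j} = {f j}"
      using f[OF ij(1)] f[OF ij(2)] unique[OF ij(1)] unique[OF ij(2)] by blast+
    moreover have "card {i, j} \<le> card (\<Union>k\<in>{i, j}. W `` {k})"
      using hallW ij unfolding hall_condition_def by (metis empty_subsetI finite.simps insert_subset)
    ultimately show False using ij by auto
  qed
  moreover have "\<forall>i\<in>I. f i \<in> A i" using f WS by auto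
  ultimately show ?thesis by blast
qed

section \<open>Folner sets\<close>

definition folner :: "('a, 'm) monoid_scheme \<Rightarrow> bool" where
  "folner G \<longleftrightarrow>
     (\<forall>K \<epsilon>. finite K \<longrightarrow> K \<subseteq> carrier G \<longrightarrow> 0 < \<epsilon> \<longrightarrow>
        (\<exists>F. finite F \<and> F \<noteq> {} \<and> F \<subseteq> carrier G \<and>
             (\<forall>k\<in>K. real (card {d \<in> F. k \<otimes>\<^bsub>G\<^esub> d \<notin> F}) \<le> \<epsilon> * real (card F))))"

lemma finitely_additive_UNION:
  fixes m :: "'a set \<Rightarrow> real"
  assumes add: "\<And>S T. S \<subseteq> X \<Longrightarrow> T \<subseteq> X \<Longrightarrow> S \<inter> T = {} \<Longrightarrow> m (S \<union> T) = m S + m T"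
    and J: "finite J" and sub: "\<And>j. j \<in> J \<Longrightarrow> S j \<subseteq> X" and disj: "disjoint_family_on S J"
  shows "m (\<Union>j\<in>J. S j) = (\<Sum>j\<in>J. m (S j))"
  using J sub disj
proof (induction J rule: finite_induct)
  case empty
  show ?case using add[of "{}" "{}"] by simp
next
  case (insert j J)
  have "S j \<inter> (\<Union>i\<in>J. S i) = {}"
    using insert.prems(2) insert.hyps unfolding disjoint_family_on_def by auto
  then have "m (S j \<union> (\<Union>i\<in>J. S i)) = m (S j) + m (\<Union>i\<in>J. S i)"
    using insert.prems(1) by (intro add) auto
  moreover have "disjoint_family_on S J"
    using insert.prems(2) by (rule disjoint_family_on_mono[rotated]) auto
  ultimately show ?case using insert by simp
qed

context group
begin

text \<open>Failure of the Folner condition for one \<open>K\<close> means that multiplication by \<open>insert \<one> K\<close> enlarges every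
  finite set by a fixed factor above 1; a large power of this set then doubles.\<close>

lemma not_folner_imp_doubling:
  assumes "\<not> folner G"
  shows "\<exists>L. finite L \<and> L \<subseteq> carrier G \<and>
             (\<forall>F. finite F \<longrightarrow> F \<subseteq> carrier G \<longrightarrow> 2 * card F \<le> card (L <#> F))"
proof -
  obtain K \<epsilon> where K: "finite K" "K \<subseteq> carrier G" and \<epsilon>: "0 < (\<epsilon> :: real)"
    and expand: "\<And>F. \<lbrakk>finite F; F \<noteq> {}; F \<subseteq> carrier G\<rbrakk> \<Longrightarrow>
                  \<exists>k\<in>K. \<epsilon> * real (card F) < real (card {d \<in> F. k \<otimes> d \<notin> F})"
    using assms unfolding folner_def by (meson not_le)
  let ?K = "insert \<one> K"
  have fin_mult: "finite (L <#> F)" if "finite L" "finite F" for L F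
    using that unfolding set_mult_def by auto
  have grow: "(1 + \<epsilon>) * real (card F) \<le> real (card (?K <#> F))"
    if F: "finite F" "F \<subseteq> carrier G" for F
  proof (cases "F = {}")
    case False
    then obtain k where k: "k \<in> K" and large: "\<epsilon> * real (card F) < real (card {d \<in> F. k \<otimes> d \<notin> F})"
      using expand F by blast
    let ?S = "(\<lambda>d. k \<otimes> d) ` {d \<in> F. k \<otimes> d \<notin> F}"
    have "card ?S = card {d \<in> F. k \<otimes> d \<notin> F}"
      using k K F by (intro card_image inj_onI) (auto simp: subset_iff)
    moreover have "card (F \<union> ?S) = card F + card ?S"
      using F by (intro card_Un_disjoint) auto
    \<comment> \<open>The unit in the multiplying set keeps \<open>F\<close> itself, so the translates that leave \<open>F\<close> are a pure gain.\<close>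
    moreover have "card (F \<union> ?S) \<le> card (?K <#> F)"
    proof (rule card_mono)
      show "finite (?K <#> F)" using fin_mult K F by blast
      have "F \<subseteq> ?K <#> F"
        using F unfolding set_mult_def by (force simp: subset_iff)
      moreover have "?S \<subseteq> ?K <#> F" using k unfolding set_mult_def by auto
      ultimately show "F \<union> ?S \<subseteq> ?K <#> F" by blast
    qed
    ultimately show ?thesis using large by (simp add: algebra_simps)
  qed simp
  have power: "\<exists>L. finite L \<and> L \<subseteq> carrier G \<and>
      (\<forall>F. finite F \<longrightarrow> F \<subseteq> carrier G \<longrightarrow> (1 + \<epsilon>) ^ n * real (card F) \<le> real (card (L <#> F)))" for n
  proof (induction n)
    case 0
    have "{\<one>} <#> F = F" if "F \<subseteq> carrier G" for F
      using that unfolding set_mult_def by (force simp: subset_iff)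
    then show ?case by (intro exI[of _ "{\<one>}"]) auto
  next
    case (Suc n)
    then obtain L where L: "finite L" "L \<subseteq> carrier G"
      and growL: "\<And>F. finite F \<Longrightarrow> F \<subseteq> carrier G \<Longrightarrow> (1 + \<epsilon>) ^ n * real (card F) \<le> real (card (L <#> F))"
      by blast
    have "(1 + \<epsilon>) ^ Suc n * real (card F) \<le> real (card (?K <#> L <#> F))"
      if F: "finite F" "F \<subseteq> carrier G" for F
    proof -
      have "(1 + \<epsilon>) * ((1 + \<epsilon>) ^ n * real (card F)) \<le> (1 + \<epsilon>) * real (card (L <#> F))"
        using growL[OF F] \<epsilon> by (intro mult_left_mono) auto
      also have "\<dots> \<le> real (card (?K <#> (L <#> F)))"
        using L F by (intro grow fin_mult set_mult_closed)
      also have "?K <#> (L <#> F) = ?K <#> L <#> F"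
        using K L F by (intro set_mult_assoc[symmetric]) auto
      finally show ?thesis by (simp add: mult.assoc)
    qed
    moreover have "finite (?K <#> L)" "?K <#> L \<subseteq> carrier G"
      using K L fin_mult[of ?K L] set_mult_closed[of ?K L] by simp_all
    ultimately show ?case by blast
  qed
  obtain n where n: "2 < (1 + \<epsilon>) ^ n"
    using real_arch_pow[of "1 + \<epsilon>" 2] \<epsilon> by auto
  obtain L where L: "finite L" "L \<subseteq> carrier G"
    and growL: "\<And>F. finite F \<Longrightarrow> F \<subseteq> carrier G \<Longrightarrow> (1 + \<epsilon>) ^ n * real (card F) \<le> real (card (L <#> F))"
    using power[of n] by blast
  have "2 * card F \<le> card (L <#> F)" if "finite F" "F \<subseteq> carrier G" for F
  proof -
    have "2 * real (card F) \<le> (1 + \<epsilon>) ^ n * real (card F)"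
      using n by (intro mult_right_mono) auto
    then show ?thesis using growL[OF that] by linarith
  qed
  then show ?thesis using L by blast
qed

text \<open>If the Folner condition fails, some finite \<open>L\<close> doubles every finite set, which is Hall's condition for two
  disjoint copies of the group with \<open>(g, i)\<close> matched into \<open>L <#> {g}\<close>. The matching is a
  paradoxical decomposition: it splits the group into finitely many pieces twice over, and left translates of all these
  pieces are disjoint, so an invariant mean would give the group mass at least 2.\<close>

theorem amenable_imp_folner:
  assumes "amenable G"
  shows "folner G"
proof (rule ccontr)
  assume "\<not> folner G"
  then obtain L where L: "finite L" "L \<subseteq> carrier G"
    and double: "\<And>F. finite F \<Longrightarrow> F \<subseteq> carrier G \<Longrightarrow> 2 * card F \<le> card (L <#> F)"
    using not_folner_imp_doubling by blast
  from \<open>amenable G\<close> obtain m :: "'a set \<Rightarrow> real" where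
    nonneg: "\<forall>S. S \<subseteq> carrier G \<longrightarrow> 0 \<le> m S" and
    one: "m (carrier G) = 1" and
    add: "\<forall>S T. S \<subseteq> carrier G \<longrightarrow> T \<subseteq> carrier G \<longrightarrow> S \<inter> T = {} \<longrightarrow> m (S \<union> T) = m S + m T" and
    inv: "\<forall>g\<in>carrier G. \<forall>S. S \<subseteq> carrier G \<longrightarrow> m (g <# S) = m S"
    unfolding amenable_def by (elim exE conjE)
  define I :: "('a \<times> bool) set" where "I = carrier G \<times> UNIV"
  define A where "A = (\<lambda>p :: 'a \<times> bool. (\<lambda>l. l \<otimes> fst p) ` L)"
  have "hall_condition I A"
    unfolding hall_condition_def
  proof (intro allI impI)
    fix J assume J: "J \<subseteq> I" "finite J"
    have "card J \<le> card (fst ` J \<times> (UNIV :: bool set))"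
      using J(2) subset_fst_snd[of J] by (intro card_mono finite_cartesian_product finite_imageI finite) auto
    also have "\<dots> = 2 * card (fst ` J)" by (simp add: card_cartesian_product)
    also have "\<dots> \<le> card (L <#> fst ` J)"
      using J by (intro double) (auto simp: I_def)
    also have "L <#> fst ` J = \<Union> (A ` J)"
      unfolding set_mult_def A_def by auto
    finally show "card J \<le> card (\<Union> (A ` J))" .
  qed
  then obtain f where f: "\<And>p. p \<in> I \<Longrightarrow> f p \<in> A p" and inj: "inj_on f I"
    using hall_marriage[of I A] L(1) unfolding A_def by auto
  \<comment> \<open>\<open>Q (i, l)\<close> is the piece on which the \<open>i\<close>-th matching is left translation by \<open>l\<close>.\<close>
  define Q where "Q = (\<lambda>(i, l). {g \<in> carrier G. f (g, i) = l \<otimes> g})"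
  have Q_sub: "Q p \<subseteq> carrier G" for p unfolding Q_def by (cases p) auto
  have label_unique: "l = l'" if "l \<otimes> g = l' \<otimes> g" "g \<in> carrier G" "l \<in> L" "l' \<in> L" for l l' g
    using that L(2) by (meson right_cancel subsetD)
  have half: "(\<Sum>l\<in>L. m (Q (i, l))) = 1" for i
  proof -
    have "disjoint_family_on (\<lambda>l. Q (i, l)) L"
      unfolding disjoint_family_on_def
    proof (intro ballI impI, rule ccontr)
      fix l l' assume ll: "l \<in> L" "l' \<in> L" "l \<noteq> l'" "Q (i, l) \<inter> Q (i, l') \<noteq> {}"
      then obtain g where "g \<in> carrier G" "f (g, i) = l \<otimes> g" "f (g, i) = l' \<otimes> g"
        unfolding Q_def by auto
      then show False using label_unique[of l g l'] ll by simp
    qed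
    then have "(\<Sum>l\<in>L. m (Q (i, l))) = m (\<Union>l\<in>L. Q (i, l))"
      using finitely_additive_UNION[of "carrier G" m L "\<lambda>l. Q (i, l)"] add L(1) Q_sub by simp
    also have "(\<Union>l\<in>L. Q (i, l)) = carrier G"
      using f unfolding Q_def A_def I_def by fastforce
    finally show ?thesis using one by simp
  qed
  define T where "T = (\<lambda>p :: bool \<times> 'a. snd p <# Q p)"
  let ?P = "(UNIV :: bool set) \<times> L"
  have T_sub: "T p \<subseteq> carrier G" if "p \<in> ?P" for p
    unfolding T_def using that L Q_sub by (intro l_coset_subset_G) auto
  have T_elem: "\<exists>g \<in> carrier G. y = f (g, fst p) \<and> y = snd p \<otimes> g" if "y \<in> T p" for y p
    using that unfolding T_def Q_def l_coset_def by (cases p) force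
  have disj: "disjoint_family_on T ?P"
    unfolding disjoint_family_on_def
  proof (intro ballI impI, rule ccontr)
    fix p q assume pq: "p \<in> ?P" "q \<in> ?P" "p \<noteq> q" "T p \<inter> T q \<noteq> {}"
    then obtain y where "y \<in> T p" "y \<in> T q" by blast
    then obtain g h where g: "g \<in> carrier G" "y = f (g, fst p)" "y = snd p \<otimes> g"
      and h: "h \<in> carrier G" "y = f (h, fst q)" "y = snd q \<otimes> h"
      using T_elem by meson
    have "(g, fst p) = (h, fst q)"
      using inj g h unfolding I_def by (intro inj_onD[of f I]) (auto simp: I_def)
    then have "g = h" "fst p = fst q" by auto
    moreover have "snd p = snd q"
      using label_unique[of "snd p" g "snd q"] g h pq(1,2) \<open>g = h\<close> by auto
    ultimately show False using pq(3) by (simp add: prod_eq_iff)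
  qed
  let ?U = "\<Union>p\<in>?P. T p"
  have "2 = (\<Sum>i\<in>(UNIV :: bool set). \<Sum>l\<in>L. m (Q (i, l)))"
    using half by simp
  also have "\<dots> = (\<Sum>p\<in>?P. m (Q p))" by (simp add: sum.cartesian_product)
  also have "\<dots> = (\<Sum>p\<in>?P. m (T p))"
    using L Q_sub by (intro sum.cong) (auto simp: T_def inv)
  also have "\<dots> = m ?U"
    using finitely_additive_UNION[of "carrier G" m ?P T] add L(1) T_sub disj by simp
  also have "\<dots> \<le> m (carrier G)"
  proof -
    have "?U \<subseteq> carrier G" using T_sub by blast
    then have "m (?U \<union> (carrier G - ?U)) = m ?U + m (carrier G - ?U)"
      by (intro add[rule_format]) auto
    moreover have "?U \<union> (carrier G - ?U) = carrier G" using \<open>?U \<subseteq> carrier G\<close> by blast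
    moreover have nn: "0 \<le> m (carrier G - ?U)" by (intro nonneg[rule_format]) auto
    ultimately show ?thesis by (simp only:)
  qed
  finally show False using one by simp
qed

end

lemma folner_DirProd:
  assumes G: "folner G" and H: "folner H"
  shows "folner (G \<times>\<times> H)"
  unfolding folner_def
proof (intro allI impI)
  fix K \<epsilon> assume K: "finite K" "K \<subseteq> carrier (G \<times>\<times> H)" and \<epsilon>: "0 < (\<epsilon> :: real)"
  have "fst ` K \<subseteq> carrier G" "snd ` K \<subseteq> carrier H" using K by auto
  moreover have "finite (fst ` K)" "finite (snd ` K)" "0 < \<epsilon> / 2" using K(1) \<epsilon> by auto
  ultimately have "\<exists>E. finite E \<and> E \<noteq> {} \<and> E \<subseteq> carrier G \<and>
      (\<forall>k\<in>fst ` K. real (card {d \<in> E. k \<otimes>\<^bsub>G\<^esub> d \<notin> E}) \<le> \<epsilon> / 2 * real (card E))"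
    and "\<exists>F. finite F \<and> F \<noteq> {} \<and> F \<subseteq> carrier H \<and>
      (\<forall>k\<in>snd ` K. real (card {d \<in> F. k \<otimes>\<^bsub>H\<^esub> d \<notin> F}) \<le> \<epsilon> / 2 * real (card F))"
    using G[unfolded folner_def, rule_format, of "fst ` K" "\<epsilon> / 2"]
      H[unfolded folner_def, rule_format, of "snd ` K" "\<epsilon> / 2"] by auto
  then obtain E F where E: "finite E" "E \<noteq> {}" "E \<subseteq> carrier G"
      "\<forall>k\<in>fst ` K. real (card {d \<in> E. k \<otimes>\<^bsub>G\<^esub> d \<notin> E}) \<le> \<epsilon> / 2 * real (card E)"
    and F: "finite F" "F \<noteq> {}" "F \<subseteq> carrier H"
      "\<forall>k\<in>snd ` K. real (card {d \<in> F. k \<otimes>\<^bsub>H\<^esub> d \<notin> F}) \<le> \<epsilon> / 2 * real (card F)"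
    by (elim exE conjE)
  show "\<exists>D. finite D \<and> D \<noteq> {} \<and> D \<subseteq> carrier (G \<times>\<times> H) \<and>
          (\<forall>k\<in>K. real (card {d \<in> D. k \<otimes>\<^bsub>G \<times>\<times> H\<^esub> d \<notin> D}) \<le> \<epsilon> * real (card D))"
  proof (intro exI[of _ "E \<times> F"] conjI ballI)
    fix k assume k: "k \<in> K"
    let ?E = "{d \<in> E. fst k \<otimes>\<^bsub>G\<^esub> d \<notin> E}" and ?F = "{d \<in> F. snd k \<otimes>\<^bsub>H\<^esub> d \<notin> F}"
    have "{d \<in> E \<times> F. k \<otimes>\<^bsub>G \<times>\<times> H\<^esub> d \<notin> E \<times> F} \<subseteq> ?E \<times> F \<union> E \<times> ?F"
      by (cases k) auto
    then have "card {d \<in> E \<times> F. k \<otimes>\<^bsub>G \<times>\<times> H\<^esub> d \<notin> E \<times> F} \<le> card (?E \<times> F \<union> E \<times> ?F)"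
      using E F by (intro card_mono) auto
    also have "\<dots> \<le> card ?E * card F + card E * card ?F"
      using card_Un_le[of "?E \<times> F" "E \<times> ?F"] by (simp add: card_cartesian_product)
    finally have "real (card {d \<in> E \<times> F. k \<otimes>\<^bsub>G \<times>\<times> H\<^esub> d \<notin> E \<times> F})
        \<le> real (card ?E) * real (card F) + real (card E) * real (card ?F)"
      by (simp only: of_nat_add[symmetric] of_nat_mult[symmetric] of_nat_le_iff)
    also have "\<dots> \<le> (\<epsilon> / 2 * real (card E)) * real (card F) + real (card E) * (\<epsilon> / 2 * real (card F))"
      using bspec[OF E(4), of "fst k"] bspec[OF F(4), of "snd k"] k by (intro add_mono mult_right_mono mult_left_mono) auto
    finally show "real (card {d \<in> E \<times> F. k \<otimes>\<^bsub>G \<times>\<times> H\<^esub> d \<notin> E \<times> F}) \<le> \<epsilon> * real (card (E \<times> F))"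
      by (simp add: card_cartesian_product algebra_simps)
  qed (use E F in auto)
qed

text \<open>A finite group is its own Folner set. In an infinite cyclic group the powers with exponents in an interval
  of length \<open>n\<close> lose at most \<open>\<bar>i\<bar>\<close> elements under translation by the \<open>i\<close>-th power.\<close>

lemma (in group) folner_cyclic:
  assumes b: "b \<in> carrier G"
  shows "folner (G\<lparr>carrier := generate G {b}\<rparr>)"
proof (cases "finite (generate G {b})")
  case True
  interpret H: subgroup "generate G {b}" G
    using generate_is_subgroup[of "{b}"] b by simp
  have ne: "generate G {b} \<noteq> {}" using H.one_closed by blast
  show ?thesis
    unfolding folner_def
  proof (intro allI impI exI[of _ "generate G {b}"] conjI ballI)
    fix K k and \<epsilon> :: real
    assume "K \<subseteq> carrier (G\<lparr>carrier := generate G {b}\<rparr>)" "k \<in> K" "0 < \<epsilon>"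
    then have "{d \<in> generate G {b}. k \<otimes> d \<notin> generate G {b}} = {}" by auto
    then have inv: "card {d \<in> generate G {b}. k \<otimes> d \<notin> generate G {b}} = 0" by (simp only: card.empty)
    show "real (card {d \<in> generate G {b}. k \<otimes>\<^bsub>G\<lparr>carrier := generate G {b}\<rparr>\<^esub> d \<notin> generate G {b}})
        \<le> \<epsilon> * real (card (generate G {b}))"
      using \<open>0 < \<epsilon>\<close> by (simp add: inv)
  qed (use True ne in auto)
next
  case False
  have gen: "generate G {b} = range (\<lambda>i :: int. b [^] i)"
    using generate_pow[OF b] by auto
  have inj: "i = j" if eq: "b [^] (i :: int) = b [^] j" for i j
  proof (rule ccontr)
    assume "i \<noteq> j"
    define n where "n = \<bar>i - j\<bar>"
    have n: "0 < n" using \<open>i \<noteq> j\<close> unfolding n_def by simp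
    have "b [^] (i - j) = \<one>" using eq b by (simp add: int_pow_diff)
    moreover have "b [^] (j - i) = \<one>" using eq b by (simp add: int_pow_diff)
    ultimately have bn: "b [^] n = \<one>" unfolding n_def by (simp add: abs_if)
    have "b [^] k \<in> (\<lambda>i. b [^] i) ` {0..<n}" for k :: int
    proof -
      have "b [^] k = b [^] (n * (k div n) + k mod n)" by simp
      also have "\<dots> = (b [^] n) [^] (k div n) \<otimes> b [^] (k mod n)"
        by (simp only: int_pow_mult[OF b] int_pow_pow[OF b])
      also have "\<dots> = b [^] (k mod n)" using bn b by simp
      finally show ?thesis using n by (intro image_eqI[of _ _ "k mod n"]) auto
    qed
    then have "generate G {b} \<subseteq> (\<lambda>i. b [^] i) ` {0..<n}" unfolding gen by auto
    then show False using False finite_subset by blast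
  qed
  show ?thesis
    unfolding folner_def
  proof (intro allI impI)
    fix K and \<epsilon> :: real
    assume K: "finite K" "K \<subseteq> carrier (G\<lparr>carrier := generate G {b}\<rparr>)" and \<epsilon>: "0 < \<epsilon>"
    obtain I where I: "finite I" "K = (\<lambda>i :: int. b [^] i) ` I"
      using K gen finite_subset_image[of K "\<lambda>i :: int. b [^] i" UNIV] by auto
    obtain N where N: "\<And>i. i \<in> I \<Longrightarrow> \<bar>i\<bar> \<le> int N"
    proof -
      have "\<bar>i\<bar> \<le> int (nat (\<Sum>j\<in>I. \<bar>j\<bar>))" if "i \<in> I" for i
        using member_le_sum[of i I abs] that I(1) by simp
      then show ?thesis using that by blast
    qed
    define n where "n = nat \<lceil>real N / \<epsilon>\<rceil> + 1"
    have n_pos: "0 < n" unfolding n_def by simp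
    have "real N / \<epsilon> \<le> real n" unfolding n_def by linarith
    then have n: "real N \<le> \<epsilon> * real n" using \<epsilon> by (simp add: field_simps)
    let ?F = "(\<lambda>i :: int. b [^] i) ` {0..<int n}"
    have cardF: "card ?F = n" using inj by (subst card_image) (auto intro: inj_onI)
    show "\<exists>F. finite F \<and> F \<noteq> {} \<and> F \<subseteq> carrier (G\<lparr>carrier := generate G {b}\<rparr>) \<and>
        (\<forall>k\<in>K. real (card {d \<in> F. k \<otimes>\<^bsub>G\<lparr>carrier := generate G {b}\<rparr>\<^esub> d \<notin> F}) \<le> \<epsilon> * real (card F))"
    proof (intro exI[of _ ?F] conjI ballI)
      fix k assume "k \<in> K"
      then obtain i where i: "i \<in> I" "k = b [^] i" using I by auto
      have "{d \<in> ?F. k \<otimes> d \<notin> ?F} \<subseteq> (\<lambda>j. b [^] j) ` ({0..<int n} - {- i..<int n - i})"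
      proof
        fix d assume "d \<in> {d \<in> ?F. k \<otimes> d \<notin> ?F}"
        then obtain j where j: "0 \<le> j" "j < int n" "d = b [^] j" "k \<otimes> d \<notin> ?F" by auto
        have "k \<otimes> d = b [^] (i + j)" using i j b by (simp add: int_pow_mult)
        then have "i + j \<notin> {0..<int n}" using j(4) by (metis imageI)
        then show "d \<in> (\<lambda>j. b [^] j) ` ({0..<int n} - {- i..<int n - i})" using j by auto
      qed
      then have "card {d \<in> ?F. k \<otimes> d \<notin> ?F} \<le> card ((\<lambda>j. b [^] j) ` ({0..<int n} - {- i..<int n - i}))"
        by (intro card_mono) auto
      also have "\<dots> \<le> card ({0..<int n} - {- i..<int n - i})" by (intro card_image_le) auto
      also have "\<dots> \<le> card ({0..<- i} \<union> {int n - i..<int n})" by (intro card_mono) auto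
      also have "\<dots> \<le> card {0..<- i} + card {int n - i..<int n}" by (rule card_Un_le)
      also have "\<dots> \<le> N" using N[OF i(1)] by (simp add: nat_le_iff)
      finally have "real (card {d \<in> ?F. k \<otimes> d \<notin> ?F}) \<le> real N" by simp
      then show "real (card {d \<in> ?F. k \<otimes>\<^bsub>G\<lparr>carrier := generate G {b}\<rparr>\<^esub> d \<notin> ?F}) \<le> \<epsilon> * real (card ?F)"
        using n unfolding cardF by simp
    next
      show "?F \<subseteq> carrier (G\<lparr>carrier := generate G {b}\<rparr>)" using gen by auto
    qed (use n_pos in auto)
  qed
qed

section \<open>Countable measure-preserving actions and their orbit relations\<close>

text \<open>A countable separating family makes graphs of measurable maps measurable, and it splits the complement of
  the fixed points of a group element into countably many sets disjoint from their translates.\<close>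

definition countably_separated :: "'x measure \<Rightarrow> bool" where
  "countably_separated M \<longleftrightarrow>
     (\<exists>\<B>. countable \<B> \<and> \<B> \<subseteq> sets M \<and>
        (\<forall>x\<in>space M. \<forall>y\<in>space M. x \<noteq> y \<longrightarrow> (\<exists>U\<in>\<B>. x \<in> U \<and> y \<notin> U)))"

lemma standard_borel_imp_countably_separated:
  assumes "standard_borel_space M"
  shows "countably_separated M"
proof -
  obtain T where T: "topspace T = space M" "completely_metrizable_space T" "second_countable T"
    and sets: "sets M = sigma_sets (space M) {U. openin T U}"
    using assms unfolding standard_borel_space_def by blast
  obtain \<B> where \<B>: "countable \<B>" "\<forall>V\<in>\<B>. openin T V"
    and base: "\<forall>U x. openin T U \<and> x \<in> U \<longrightarrow> (\<exists>V\<in>\<B>. x \<in> V \<and> V \<subseteq> U)"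
    using T(3) unfolding second_countable_def by (elim exE conjE)
  have "t1_space T"
    using T(2) completely_metrizable_imp_metrizable_space metrizable_imp_t1_space by blast
  then have "\<exists>U\<in>\<B>. x \<in> U \<and> y \<notin> U" if xy: "x \<in> space M" "y \<in> space M" "x \<noteq> y" for x y
  proof -
    obtain U where "openin T U" "x \<in> U" "y \<notin> U"
      using \<open>t1_space T\<close>[unfolded t1_space_def, rule_format, of x y] xy
      unfolding T(1) by blast
    moreover have "\<exists>V\<in>\<B>. x \<in> V \<and> V \<subseteq> U"
      by (rule base[rule_format]) (use \<open>openin T U\<close> \<open>x \<in> U\<close> in simp)
    ultimately show ?thesis by blast
  qed
  moreover have "\<B> \<subseteq> sets M"
    using \<B>(2) sets by (auto intro: sigma_sets.Basic)
  ultimately show ?thesis using \<B>(1) unfolding countably_separated_def by blast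
qed

lemma sets_diagonal:
  assumes "countably_separated M"
  shows "{p \<in> space (M \<Otimes>\<^sub>M M). fst p = snd p} \<in> sets (M \<Otimes>\<^sub>M M)"
proof -
  obtain \<B> where \<B>: "countable \<B>" "\<B> \<subseteq> sets M"
    and sep: "\<forall>x\<in>space M. \<forall>y\<in>space M. x \<noteq> y \<longrightarrow> (\<exists>U\<in>\<B>. x \<in> U \<and> y \<notin> U)"
    using assms unfolding countably_separated_def by (elim exE conjE)
  have "{p \<in> space (M \<Otimes>\<^sub>M M). fst p = snd p}
      = space (M \<Otimes>\<^sub>M M) - (\<Union>U\<in>\<B>. U \<times> (space M - U))" (is "?D = ?E")
  proof (rule Set.set_eqI)
    fix p show "p \<in> ?D \<longleftrightarrow> p \<in> ?E"
      using sep[rule_format, of "fst p" "snd p"] by (cases p) (auto simp: space_pair_measure)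
  qed
  moreover have "(\<Union>U\<in>\<B>. U \<times> (space M - U)) \<in> sets (M \<Otimes>\<^sub>M M)"
    using \<B> by (intro sets.countable_UN') auto
  ultimately show ?thesis by simp
qed

lemma sets_graph:
  assumes "countably_separated M" and f: "f \<in> measurable M M"
  shows "{(x, f x) | x. x \<in> space M} \<in> sets (M \<Otimes>\<^sub>M M)"
proof -
  let ?D = "{p \<in> space (M \<Otimes>\<^sub>M M). fst p = snd p}"
  have "(\<lambda>p. (f (fst p), snd p)) \<in> measurable (M \<Otimes>\<^sub>M M) (M \<Otimes>\<^sub>M M)"
    using f by measurable
  from measurable_sets[OF this sets_diagonal[OF assms(1)]]
  have "(\<lambda>p. (f (fst p), snd p)) -` ?D \<inter> space (M \<Otimes>\<^sub>M M) \<in> sets (M \<Otimes>\<^sub>M M)" .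
  also have "(\<lambda>p. (f (fst p), snd p)) -` ?D \<inter> space (M \<Otimes>\<^sub>M M) = {(x, f x) | x. x \<in> space M}"
    using measurable_space[OF f] by (auto simp: space_pair_measure)
  finally show ?thesis .
qed

locale countable_pmp_action =
  fixes G (structure) and M :: "'x measure" and \<phi>
  assumes pmp: "pmp_action G M \<phi>"
    and countable_group: "countable (carrier G)"
    and separated: "countably_separated M"

sublocale countable_pmp_action \<subseteq> action: group_action G "space M" \<phi>
  using pmp unfolding pmp_action_def by blast

sublocale countable_pmp_action \<subseteq> prob_space M
  using pmp unfolding pmp_action_def by blast

sublocale countable_pmp_action \<subseteq> group G
  using action.group_hom group_hom.axioms(1) by blast

context countable_pmp_action
begin

lemma act_measurable [measurable]: "g \<in> carrier G \<Longrightarrow> \<phi> g \<in> measurable M M"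
  using pmp unfolding pmp_action_def by blast

lemma distr_act: "g \<in> carrier G \<Longrightarrow> distr M M (\<phi> g) = M"
  using pmp unfolding pmp_action_def by blast

lemma act_space [simp]: "g \<in> carrier G \<Longrightarrow> x \<in> space M \<Longrightarrow> \<phi> g x \<in> space M"
  using measurable_space[OF act_measurable] .

lemma act_mult:
  "x \<in> space M \<Longrightarrow> g \<in> carrier G \<Longrightarrow> h \<in> carrier G \<Longrightarrow> \<phi> g (\<phi> h x) = \<phi> (g \<otimes> h) x"
  using action.composition_rule by simp

lemma act_one [simp]: "x \<in> space M \<Longrightarrow> \<phi> \<one> x = x"
  using action.id_eq_one by (metis restrict_apply')

lemma act_inv_act [simp]: "x \<in> space M \<Longrightarrow> g \<in> carrier G \<Longrightarrow> \<phi> (inv g) (\<phi> g x) = x"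
  by (simp add: act_mult)

lemma act_act_inv [simp]: "x \<in> space M \<Longrightarrow> g \<in> carrier G \<Longrightarrow> \<phi> g (\<phi> (inv g) x) = x"
  by (simp add: act_mult)

lemma sets_act_vimage [measurable]:
  "g \<in> carrier G \<Longrightarrow> C \<in> sets M \<Longrightarrow> {x \<in> space M. \<phi> g x \<in> C} \<in> sets M"
  using measurable_sets[OF act_measurable, of g C] by (simp add: vimage_def Int_def conj_commute)

lemma measure_act_vimage:
  assumes "g \<in> carrier G" "C \<in> sets M"
  shows "measure M {x \<in> space M. \<phi> g x \<in> C} = measure M C"
proof -
  have "measure M C = measure (distr M M (\<phi> g)) C" using distr_act assms(1) by simp
  also have "\<dots> = measure M (\<phi> g -` C \<inter> space M)"
    using assms by (intro measure_distr) auto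
  also have "\<phi> g -` C \<inter> space M = {x \<in> space M. \<phi> g x \<in> C}" by auto
  finally show ?thesis by simp
qed

lemma act_image_eq_vimage:
  assumes "g \<in> carrier G" "C \<subseteq> space M"
  shows "\<phi> g ` C = {x \<in> space M. \<phi> (inv g) x \<in> C}"
proof (intro equalityI subsetI)
  fix y assume "y \<in> {x \<in> space M. \<phi> (inv g) x \<in> C}"
  then show "y \<in> \<phi> g ` C" using assms by (intro image_eqI[of _ _ "\<phi> (inv g) y"]) auto
qed (use assms in auto)

lemma sets_act_image: "g \<in> carrier G \<Longrightarrow> C \<in> sets M \<Longrightarrow> \<phi> g ` C \<in> sets M"
  using sets.sets_into_space by (subst act_image_eq_vimage) auto

lemma measure_act_image: "g \<in> carrier G \<Longrightarrow> C \<in> sets M \<Longrightarrow> measure M (\<phi> g ` C) = measure M C"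
  using sets.sets_into_space by (subst act_image_eq_vimage) (auto simp: measure_act_vimage)

lemma AE_act:
  assumes "g \<in> carrier G" "AE x in M. P x"
  shows "AE x in M. P (\<phi> g x)"
proof -
  have "AE x in distr M M (\<phi> g). P x" using assms(2) unfolding distr_act[OF assms(1)] .
  then show ?thesis using assms(1) by (intro AE_distrD[of "\<phi> g" M M]) auto
qed

lemma sets_orbit_rel: "orbit_rel G M \<phi> \<in> sets (M \<Otimes>\<^sub>M M)"
proof -
  have "orbit_rel G M \<phi> = (\<Union>g\<in>carrier G. {(x, \<phi> g x) | x. x \<in> space M})"
    unfolding orbit_rel_def by auto
  also have "\<dots> \<in> sets (M \<Otimes>\<^sub>M M)"
    using countable_group separated
    by (intro sets.countable_UN') (auto intro!: sets_graph act_measurable)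
  finally show ?thesis .
qed

lemma in_orbit_relI: "x \<in> space M \<Longrightarrow> g \<in> carrier G \<Longrightarrow> (x, \<phi> g x) \<in> orbit_rel G M \<phi>"
  unfolding orbit_rel_def by auto

lemma equiv_orbit_rel: "equiv (space M) (orbit_rel G M \<phi>)"
proof (intro equivI)
  show "refl_on (space M) (orbit_rel G M \<phi>)"
    using in_orbit_relI[of _ \<one>] by (auto intro!: refl_onI)
  show "sym (orbit_rel G M \<phi>)"
    unfolding orbit_rel_def
  proof (rule symI)
    fix x y assume "(x, y) \<in> {(x, \<phi> g x) | x g. x \<in> space M \<and> g \<in> carrier G}"
    then obtain g where "x \<in> space M" "g \<in> carrier G" "y = \<phi> g x" by auto
    then have "(y, x) = (y, \<phi> (inv g) y)" "y \<in> space M" "inv g \<in> carrier G" by auto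
    then show "(y, x) \<in> {(x, \<phi> g x) | x g. x \<in> space M \<and> g \<in> carrier G}" by blast
  qed
  show "trans (orbit_rel G M \<phi>)"
  proof (rule transI)
    fix x y z assume "(x, y) \<in> orbit_rel G M \<phi>" "(y, z) \<in> orbit_rel G M \<phi>"
    then obtain g h where "x \<in> space M" "g \<in> carrier G" "y = \<phi> g x" "h \<in> carrier G" "z = \<phi> h y"
      unfolding orbit_rel_def by auto
    then show "(x, z) \<in> orbit_rel G M \<phi>"
      using in_orbit_relI[of x "h \<otimes> g"] by (simp add: act_mult)
  qed
  show "orbit_rel G M \<phi> \<subseteq> space M \<times> space M" unfolding orbit_rel_def by auto
qed

lemma subequiv_rel_orbit_rel: "subequiv_rel M (orbit_rel G M \<phi>) (orbit_rel G M \<phi>)"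
  unfolding subequiv_rel_def using sets_orbit_rel equiv_orbit_rel by blast

lemma sets_in_rel:
  assumes "F \<in> sets (M \<Otimes>\<^sub>M M)" "g \<in> carrier G" "h \<in> carrier G"
  shows "{x \<in> space M. (\<phi> g x, \<phi> h x) \<in> F} \<in> sets M"
proof -
  have "(\<lambda>x. (\<phi> g x, \<phi> h x)) \<in> measurable M (M \<Otimes>\<^sub>M M)" using assms by measurable
  from measurable_sets[OF this assms(1)] show ?thesis by (simp add: vimage_def Int_def conj_commute)
qed

lemma sets_in_rel1:
  assumes F: "F \<in> sets (M \<Otimes>\<^sub>M M)" and g: "g \<in> carrier G"
  shows "{x \<in> space M. (x, \<phi> g x) \<in> F} \<in> sets M"
proof -
  have "{x \<in> space M. (x, \<phi> g x) \<in> F} = {x \<in> space M. (\<phi> \<one> x, \<phi> g x) \<in> F}" by auto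
  then show ?thesis using sets_in_rel[OF F one_closed g] by simp
qed

text \<open>A subset of the orbit relation is covered by the countably many graphs of the group elements, so being null
  can be tested on each graph. All later statements about relations modulo null sets go through this.\<close>

lemma rel_measure_eq_0_iff:
  assumes F: "F \<in> sets (M \<Otimes>\<^sub>M M)" and sub: "F \<subseteq> orbit_rel G M \<phi>"
  shows "rel_measure M F = 0 \<longleftrightarrow> (\<forall>g\<in>carrier G. AE x in M. (x, \<phi> g x) \<notin> F)"
proof
  assume null: "rel_measure M F = 0"
  show "\<forall>g\<in>carrier G. AE x in M. (x, \<phi> g x) \<notin> F"
  proof
    fix g assume g: "g \<in> carrier G"
    let ?A = "{x \<in> space M. (x, \<phi> g x) \<in> F}"
    have A: "?A \<in> sets M" using sets_in_rel1[OF F g] .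
    have "emeasure M ?A = (\<integral>\<^sup>+ x. indicator ?A x \<partial>M)" using A by simp
    also have "\<dots> \<le> rel_measure M F"
      unfolding rel_measure_def
    proof (intro nn_integral_mono)
      fix x
      have "emeasure (count_space UNIV) {\<phi> g x} \<le> emeasure (count_space UNIV) (F `` {x})"
        if "(x, \<phi> g x) \<in> F"
        using that by (intro emeasure_mono) auto
      then show "indicator ?A x \<le> emeasure (count_space UNIV) (F `` {x})"
        by (auto simp: indicator_def)
    qed
    finally have "emeasure M ?A = 0" using null by simp
    then show "AE x in M. (x, \<phi> g x) \<notin> F"
      using A by (subst AE_iff_measurable[of ?A]) auto
  qed
next
  assume "\<forall>g\<in>carrier G. AE x in M. (x, \<phi> g x) \<notin> F"
  then have "AE x in M. \<forall>g\<in>carrier G. (x, \<phi> g x) \<notin> F"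
    using countable_group by (simp add: AE_ball_countable)
  then have "AE x in M. emeasure (count_space UNIV) (F `` {x}) = 0"
  proof (eventually_elim)
    case (elim x)
    have "F `` {x} = {}" using elim sub unfolding orbit_rel_def by auto
    then show ?case by simp
  qed
  then have "rel_measure M F = (\<integral>\<^sup>+ x. 0 \<partial>M)"
    unfolding rel_measure_def by (rule nn_integral_cong_AE)
  then show "rel_measure M F = 0" by simp
qed

end

locale free_countable_pmp_action = countable_pmp_action G M \<phi>
  for G (structure) and M :: "'x measure" and \<phi> +
  assumes free: "essentially_free G M \<phi>"
begin

definition free_part :: "'x set" where
  "free_part = {x \<in> space M. \<forall>g\<in>carrier G. \<phi> g x = x \<longrightarrow> g = \<one>}"

lemma sets_fixed_points:
  assumes "g \<in> carrier G"
  shows "{x \<in> space M. \<phi> g x = x} \<in> sets M"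
proof -
  have "{x \<in> space M. (x, \<phi> g x) \<in> {p \<in> space (M \<Otimes>\<^sub>M M). fst p = snd p}} \<in> sets M"
    by (intro sets_in_rel1 sets_diagonal separated assms)
  also have "{x \<in> space M. (x, \<phi> g x) \<in> {p \<in> space (M \<Otimes>\<^sub>M M). fst p = snd p}} = {x \<in> space M. \<phi> g x = x}"
    using assms by (auto simp: space_pair_measure)
  finally show ?thesis .
qed

lemma sets_free_part: "free_part \<in> sets M"
proof -
  have "free_part = space M - (\<Union>g\<in>carrier G - {\<one>}. {x \<in> space M. \<phi> g x = x})"
    unfolding free_part_def by auto
  moreover have "(\<Union>g\<in>carrier G - {\<one>}. {x \<in> space M. \<phi> g x = x}) \<in> sets M"
    using countable_group sets_fixed_points by (intro sets.countable_UN') auto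
  ultimately show ?thesis by simp
qed

lemma AE_free_part: "AE x in M. x \<in> free_part"
  using free AE_space unfolding essentially_free_def
proof eventually_elim
  case (elim x)
  then show ?case unfolding free_part_def stabilizer_def by auto
qed

lemma free_part_act:
  assumes "x \<in> free_part" "g \<in> carrier G" "h \<in> carrier G" "\<phi> g x = \<phi> h x"
  shows "g = h"
proof -
  have x: "x \<in> space M" using assms(1) unfolding free_part_def by blast
  have "\<phi> (inv h \<otimes> g) x = \<phi> (inv h) (\<phi> g x)" using x assms(2,3) by (simp add: act_mult)
  also have "\<dots> = x" using x assms(3,4) by simp
  finally have "inv h \<otimes> g = \<one>" using assms unfolding free_part_def by auto
  then show ?thesis using assms by (metis inv_closed inv_equality inv_inv)
qed

text \<open>For one \<open>g\<close>, every free point \<open>x\<close> has some set \<open>U\<close> of a countable separating family with \<open>x \<in> U\<close> and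
  \<open>\<phi> g x \<notin> U\<close>. So the sets \<open>C \<inter> U - {x. \<phi> g x \<in> U}\<close> cover \<open>C\<close>, each is disjoint from its \<open>g\<close>-translate, and one of
  them has positive measure. Finitely many \<open>g\<close> are treated one after another.\<close>

lemma exists_disjoint_translates:
  assumes L: "finite L" "L \<subseteq> carrier G - {\<one>}"
    and Z: "Z \<in> sets M" "Z \<subseteq> free_part" "0 < measure M Z"
  shows "\<exists>C\<in>sets M. C \<subseteq> Z \<and> 0 < measure M C \<and> (\<forall>g\<in>L. \<forall>x\<in>C. \<phi> g x \<notin> C)"
  using L
proof (induction L rule: finite_induct)
  case empty
  then show ?case using Z by blast
next
  case (insert g L)
  then obtain C where C: "C \<in> sets M" "C \<subseteq> Z" "0 < measure M C" "\<forall>g\<in>L. \<forall>x\<in>C. \<phi> g x \<notin> C"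
    by blast
  have g: "g \<in> carrier G" "g \<noteq> \<one>" using insert.prems by auto
  obtain \<B> where \<B>: "countable \<B>" "\<B> \<subseteq> sets M"
    and sep: "\<forall>x\<in>space M. \<forall>y\<in>space M. x \<noteq> y \<longrightarrow> (\<exists>U\<in>\<B>. x \<in> U \<and> y \<notin> U)"
    using separated unfolding countably_separated_def by (elim exE conjE)
  define D where "D U = C \<inter> U - {x \<in> space M. \<phi> g x \<in> U}" for U
  have D_sets: "D U \<in> sets M" if "U \<in> \<B>" for U
    unfolding D_def using that \<B> C(1) g(1) by (intro sets.Diff sets.Int sets_act_vimage) auto
  have cover: "C \<subseteq> (\<Union>U\<in>\<B>. D U)"
  proof
    fix x assume x: "x \<in> C"
    then have "x \<in> space M" "\<phi> g x \<noteq> x"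
      using C(2) Z(2) g unfolding free_part_def by auto
    then show "x \<in> (\<Union>U\<in>\<B>. D U)"
      using sep[rule_format, of x "\<phi> g x"] g x unfolding D_def by auto
  qed
  have "\<exists>U\<in>\<B>. measure M (D U) \<noteq> 0"
  proof (rule ccontr)
    assume "\<not> ?thesis"
    then have "D U \<in> null_sets M" if "U \<in> \<B>" for U
      using that D_sets by (auto simp: null_sets_def emeasure_eq_measure)
    then have "(\<Union>U\<in>\<B>. D U) \<in> null_sets M" using \<B>(1) by (intro null_sets_UN') auto
    then have "C \<in> null_sets M" using C(1) cover by (rule null_sets_subset)
    then show False using C(3) by (auto simp: null_sets_def emeasure_eq_measure)
  qed
  then obtain U where U: "U \<in> \<B>" "0 < measure M (D U)"
    by (metis measure_nonneg order_less_le)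
  show ?case
  proof (intro bexI[of _ "D U"] conjI ballI)
    fix h x assume "h \<in> insert g L" "x \<in> D U"
    then show "\<phi> h x \<notin> D U"
      using C(4) sets.sets_into_space[OF C(1)] unfolding D_def by auto
  next
    show "D U \<subseteq> Z" using C(2) unfolding D_def by auto
  qed (use U D_sets in auto)
qed

end

section \<open>The Ornstein-Weiss theorem\<close>

text \<open>The usual exhaustion: extend so that at each step at least half of the gain that is still possible is
  realised. An upper bound of the resulting chain allows no further gain. Only countable chains occur, which is what makes
  this usable for measurable objects where Zorn's lemma is not.\<close>

lemma exists_maximal_by_exhaustion:
  fixes f :: "'c \<Rightarrow> real"
  assumes start: "a0 \<in> X" and refl: "\<And>a. a \<in> X \<Longrightarrow> below a a"
    and trans: "\<And>a b c. below a b \<Longrightarrow> below b c \<Longrightarrow> below a c"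
    and mono: "\<And>a b. a \<in> X \<Longrightarrow> b \<in> X \<Longrightarrow> below a b \<Longrightarrow> f a \<le> f b"
    and bounded: "\<And>a. a \<in> X \<Longrightarrow> f a \<le> c"
    and chain: "\<And>s :: nat \<Rightarrow> 'c. (\<And>n. s n \<in> X) \<Longrightarrow> (\<And>n. below (s n) (s (Suc n))) \<Longrightarrow>
                  \<exists>u\<in>X. \<forall>n. below (s n) u"
  shows "\<exists>a\<in>X. \<forall>b\<in>X. below a b \<longrightarrow> f b \<le> f a"
proof -
  have half: "\<exists>b. b \<in> X \<and> below a b \<and> (\<forall>d\<in>X. below a d \<longrightarrow> (f d + f a) / 2 \<le> f b)" if a: "a \<in> X" for a
  proof -
    define S where "S = Sup (f ` {b \<in> X. below a b})"
    have bdd: "bdd_above (f ` {b \<in> X. below a b})" using bounded by (auto intro!: bdd_aboveI[of _ c])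
    have up: "f d \<le> S" if "d \<in> X" "below a d" for d
      unfolding S_def using that bdd by (intro cSup_upper) auto
    show ?thesis
    proof (cases "f a < S")
      case True
      then have "(S + f a) / 2 < Sup (f ` {b \<in> X. below a b})" unfolding S_def by simp
      moreover have "f ` {b \<in> X. below a b} \<noteq> {}" using a refl by auto
      ultimately obtain b where "b \<in> X" "below a b" "(S + f a) / 2 < f b"
        using less_cSupD[of "f ` {b \<in> X. below a b}" "(S + f a) / 2"] by auto
      then show ?thesis using up by (intro exI[of _ b]) fastforce
    next
      case False
      then show ?thesis using a refl up by (intro exI[of _ a]) fastforce
    qed
  qed
  obtain s where s: "\<And>n. s n \<in> X"
    "\<And>n. below (s n) (s (Suc n)) \<and> (\<forall>d\<in>X. below (s n) d \<longrightarrow> (f d + f (s n)) / 2 \<le> f (s (Suc n)))"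
    using dependent_nat_choice[of "\<lambda>_ a. a \<in> X"
        "\<lambda>_ a b. below a b \<and> (\<forall>d\<in>X. below a d \<longrightarrow> (f d + f a) / 2 \<le> f b)"] start half by metis
  then obtain u where u: "u \<in> X" "\<forall>n. below (s n) u" using chain[of s] by blast
  show ?thesis
  proof (intro bexI[of _ u] ballI impI)
    fix b assume b: "b \<in> X" "below u b"
    have "incseq (\<lambda>n. f (s n))" using s mono by (intro incseq_SucI) blast
    then obtain l where l: "(\<lambda>n. f (s n)) \<longlonglongrightarrow> l"
      using incseq_convergent[of "\<lambda>n. f (s n)" c] bounded s(1) by metis
    have "(f b + f (s n)) / 2 \<le> f (s (Suc n))" for n
      using s(2)[of n] trans[OF _ b(2)] u(2) b(1) by blast
    moreover have "(\<lambda>n. (f b + f (s n)) / 2) \<longlonglongrightarrow> (f b + l) / 2"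
      by (intro tendsto_intros l) auto
    moreover have "(\<lambda>n. f (s (Suc n))) \<longlonglongrightarrow> l" using l by (rule LIMSEQ_Suc)
    ultimately have "(f b + l) / 2 \<le> l" by (intro LIMSEQ_le) auto
    moreover have "l \<le> f u" using u s(1) mono by (intro LIMSEQ_le_const2[OF l]) blast
    ultimately show "f b \<le> f u" by simp
  qed (rule u(1))
qed

context free_countable_pmp_action
begin

text \<open>The tiles are the classes of \<open>E\<close>, and \<open>P\<close> is the region that they cover.\<close>

definition finite_tiling :: "'x set \<Rightarrow> 'x rel \<Rightarrow> bool" where
  "finite_tiling P E \<longleftrightarrow> P \<in> sets M \<and> E \<in> sets (M \<Otimes>\<^sub>M M) \<and> E \<subseteq> orbit_rel G M \<phi> \<and>
     equiv P E \<and> (\<forall>x. finite (E `` {x}))"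

text \<open>The edges \<open>x\<close> to \<open>\<phi> k x\<close> inside \<open>Y\<close> that touch the tiled region but do not stay in one tile. Edges with
  either end in \<open>P\<close> are counted, so that an edge leaving \<open>P\<close> is already paid for when the rest of \<open>Y\<close> is tiled later.\<close>

definition cut :: "'x set \<Rightarrow> 'a \<Rightarrow> 'x set \<Rightarrow> 'x rel \<Rightarrow> 'x set" where
  "cut Y k P E = {x \<in> Y. \<phi> k x \<in> Y \<and> (x \<in> P \<or> \<phi> k x \<in> P) \<and> (x, \<phi> k x) \<notin> E}"

lemma sets_cut:
  assumes "Y \<in> sets M" "k \<in> carrier G" "P \<in> sets M" "E \<in> sets (M \<Otimes>\<^sub>M M)"
  shows "cut Y k P E \<in> sets M"
proof -
  have "cut Y k P E = Y \<inter> {x \<in> space M. \<phi> k x \<in> Y} \<inter> (P \<union> {x \<in> space M. \<phi> k x \<in> P})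
      - {x \<in> space M. (x, \<phi> k x) \<in> E}"
    unfolding cut_def using sets.sets_into_space[OF assms(1)] by auto
  also have "\<dots> \<in> sets M"
    using assms by (intro sets.Diff sets.Int sets.Un sets_act_vimage sets_in_rel1)
  finally show ?thesis .
qed

text \<open>On average over \<open>x\<close>, a proportion \<open>measure M Y\<close> of the translates of \<open>x\<close> by \<open>F\<close> lies in \<open>Y\<close>, since the action
  preserves the measure. Hence the proportion is at least half of that on a set of positive measure, and one of
  the finitely many possible sets of return elements occurs there with positive measure.\<close>

lemma exists_large_return_set:
  assumes F: "finite F" "F \<noteq> {}" "F \<subseteq> carrier G" and Y: "Y \<in> sets M" "0 < measure M Y"
  shows "\<exists>D Z. D \<subseteq> F \<and> measure M Y / 2 * real (card F) \<le> real (card D) \<and>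
           Z \<in> sets M \<and> Z \<subseteq> free_part \<and> 0 < measure M Z \<and> (\<forall>x\<in>Z. {d \<in> F. \<phi> d x \<in> Y} = D)"
proof (rule ccontr)
  assume none: "\<not> ?thesis"
  define c where "c = measure M Y / 2 * real (card F)"
  define Z where "Z D = free_part \<inter> (\<Inter>d\<in>F. if d \<in> D then {x \<in> space M. \<phi> d x \<in> Y}
                                   else space M - {x \<in> space M. \<phi> d x \<in> Y})" for D
  have Z_sets: "Z D \<in> sets M" for D
    unfolding Z_def using F Y sets_free_part
    by (intro sets.Int sets.finite_INT) (auto intro!: sets.Diff sets_act_vimage)
  have Z_eq: "x \<in> Z D \<longleftrightarrow> x \<in> free_part \<and> {d \<in> F. \<phi> d x \<in> Y} = D" if "D \<subseteq> F" for x D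
  proof -
    have "x \<in> Z D \<longleftrightarrow> x \<in> free_part \<and> (\<forall>d\<in>F. \<phi> d x \<in> Y \<longleftrightarrow> d \<in> D)"
    proof (cases "x \<in> free_part")
      case True
      then have "x \<in> space M" unfolding free_part_def by blast
      then have "x \<in> (if d \<in> D then {x \<in> space M. \<phi> d x \<in> Y} else space M - {x \<in> space M. \<phi> d x \<in> Y})
          \<longleftrightarrow> (\<phi> d x \<in> Y \<longleftrightarrow> d \<in> D)" for d by simp
      then show ?thesis unfolding Z_def by (simp only: Int_iff INT_iff)
    qed (simp add: Z_def)
    also have "(\<forall>d\<in>F. \<phi> d x \<in> Y \<longleftrightarrow> d \<in> D) \<longleftrightarrow> {d \<in> F. \<phi> d x \<in> Y} = D"
      using that by blast
    finally show ?thesis .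
  qed
  have null: "AE x in M. x \<notin> Z D" if D: "D \<in> {D \<in> Pow F. c \<le> real (card D)}" for D
  proof -
    have "\<not> 0 < measure M (Z D)"
    proof
      assume "0 < measure M (Z D)"
      then have "D \<subseteq> F \<and> measure M Y / 2 * real (card F) \<le> real (card D) \<and>
           Z D \<in> sets M \<and> Z D \<subseteq> free_part \<and> 0 < measure M (Z D) \<and> (\<forall>x\<in>Z D. {d \<in> F. \<phi> d x \<in> Y} = D)"
        using D Z_sets Z_eq[of D] unfolding c_def by auto
      then show False using none by blast
    qed
    then have "Z D \<in> null_sets M"
      using Z_sets measure_nonneg[of M "Z D"] by (auto simp: null_sets_def emeasure_eq_measure)
    then show ?thesis by (rule AE_not_in)
  qed
  define f where "f x = (\<Sum>d\<in>F. indicator {x \<in> space M. \<phi> d x \<in> Y} x :: real)" for x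
  have ret: "{x \<in> space M. \<phi> d x \<in> Y} \<in> sets M" if "d \<in> F" for d
    using that F Y by (intro sets_act_vimage) auto
  have int: "integrable M f"
    unfolding f_def using ret by (intro Bochner_Integration.integrable_sum) (auto simp: integrable_indicator_iff emeasure_eq_measure)
  have "integral\<^sup>L M f = (\<Sum>d\<in>F. measure M {x \<in> space M. \<phi> d x \<in> Y})"
    unfolding f_def using ret
    by (subst Bochner_Integration.integral_sum) (auto simp: integrable_indicator_iff emeasure_eq_measure Int_def conj_commute)
  also have "\<dots> = (\<Sum>d\<in>F. measure M Y)"
    using F Y by (intro sum.cong measure_act_vimage) auto
  also have "\<dots> = real (card F) * measure M Y" by simp
  finally have mean: "integral\<^sup>L M f = real (card F) * measure M Y" .
  have "AE x in M. \<forall>D\<in>{D \<in> Pow F. c \<le> real (card D)}. x \<notin> Z D"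
    using null F(1) by (intro AE_finite_allI) auto
  then have "AE x in M. f x \<le> c"
    using AE_free_part
  proof eventually_elim
    case (elim x)
    have "x \<in> space M" using elim unfolding free_part_def by blast
    then have "f x = real (card {d \<in> F. \<phi> d x \<in> Y})"
      unfolding f_def using F(1) by (simp add: indicator_def sum.If_cases Int_def)
    moreover have "x \<in> Z {d \<in> F. \<phi> d x \<in> Y}" using elim by (subst Z_eq) auto
    then have "{d \<in> F. \<phi> d x \<in> Y} \<notin> {D \<in> Pow F. c \<le> real (card D)}" using elim(1) by blast
    then have "\<not> c \<le> real (card {d \<in> F. \<phi> d x \<in> Y})" by blast
    ultimately show ?case by linarith
  qed
  then have "integral\<^sup>L M f \<le> integral\<^sup>L M (\<lambda>_. c)" by (intro integral_mono_AE int) auto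
  then have "real (card F) * measure M Y \<le> c" using mean by (simp add: prob_space)
  moreover have "0 < real (card F) * measure M Y" using F Y by (simp add: card_gt_0_iff)
  ultimately show False unfolding c_def by simp
qed

lemma tiling_of_disjoint_translates:
  assumes D: "finite D" "D \<subseteq> carrier G" and C: "C \<in> sets M"
    and disj: "\<And>x y d e. \<lbrakk>x \<in> C; y \<in> C; d \<in> D; e \<in> D; \<phi> d x = \<phi> e y\<rbrakk> \<Longrightarrow> x = y \<and> d = e"
  defines "P \<equiv> \<Union>d\<in>D. \<phi> d ` C" and "E \<equiv> {(\<phi> d x, \<phi> e x) | x d e. x \<in> C \<and> d \<in> D \<and> e \<in> D}"
  shows "finite_tiling P E" and "measure M P = real (card D) * measure M C"
proof -
  have CX: "x \<in> space M" if "x \<in> C" for x using sets.sets_into_space[OF C] that by blast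
  have P: "P \<in> sets M" unfolding P_def using D C by (intro sets.finite_UN sets_act_image) auto
  have move: "\<phi> (e \<otimes> inv d) (\<phi> d x) = \<phi> e x" if "x \<in> C" "d \<in> D" "e \<in> D" for x d e
  proof -
    have de: "d \<in> carrier G" "e \<in> carrier G" using that D by auto
    have "\<phi> (e \<otimes> inv d) (\<phi> d x) = \<phi> e (\<phi> (inv d) (\<phi> d x))"
      using CX that de by (intro act_mult[symmetric]) auto
    then show ?thesis using CX that de by simp
  qed
  have E_eq: "E = (\<Union>d\<in>D. \<Union>e\<in>D. {(x, \<phi> (e \<otimes> inv d) x) | x. x \<in> space M} \<inter> (\<phi> d ` C \<times> space M))"
    (is "E = ?U")
  proof (intro equalityI subsetI)
    fix p assume "p \<in> E"
    then obtain x d e where p: "p = (\<phi> d x, \<phi> e x)" "x \<in> C" "d \<in> D" "e \<in> D" unfolding E_def by blast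
    then have "\<phi> d x \<in> space M" "\<phi> e x \<in> space M" using CX D by auto
    then show "p \<in> ?U" using p move[OF p(2-4)] by (intro UN_I[of d] UN_I[of e] IntI) auto
  next
    fix p assume "p \<in> ?U"
    then obtain d e x where "d \<in> D" "e \<in> D" "x \<in> C" "p = (\<phi> d x, \<phi> (e \<otimes> inv d) (\<phi> d x))" by auto
    then show "p \<in> E" using move unfolding E_def by auto
  qed
  have "E \<in> sets (M \<Otimes>\<^sub>M M)"
    unfolding E_eq using D C separated
    by (intro sets.finite_UN sets.Int sets_graph pair_measureI sets_act_image) (auto intro!: act_measurable)
  moreover have "E \<subseteq> orbit_rel G M \<phi>"
  proof
    fix p assume "p \<in> E"
    then obtain x d e where p: "p = (\<phi> d x, \<phi> e x)" "x \<in> C" "d \<in> D" "e \<in> D" unfolding E_def by blast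
    then show "p \<in> orbit_rel G M \<phi>"
      using in_orbit_relI[of "\<phi> d x" "e \<otimes> inv d"] move[of x d e] CX D by (auto simp: subset_iff)
  qed
  moreover have "equiv P E"
  proof (rule equivI)
    show "refl_on P E" unfolding P_def E_def by (rule refl_onI) auto
    show "sym E" unfolding E_def by (rule symI) auto
    show "trans E"
    proof (rule transI)
      fix u v w assume "(u, v) \<in> E" "(v, w) \<in> E"
      then obtain x d e y d' e' where "u = \<phi> d x" "v = \<phi> e x" "v = \<phi> d' y" "w = \<phi> e' y"
        "x \<in> C" "y \<in> C" "d \<in> D" "e \<in> D" "d' \<in> D" "e' \<in> D" unfolding E_def by blast
      moreover have "x = y" using disj[of x y e d'] calculation by simp
      ultimately show "(u, w) \<in> E" unfolding E_def by blast
    qed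
    show "E \<subseteq> P \<times> P" unfolding P_def E_def by auto
  qed
  moreover have "finite (E `` {u})" for u
  proof (cases "u \<in> P")
    case True
    then obtain d x where dx: "d \<in> D" "x \<in> C" "u = \<phi> d x" unfolding P_def by blast
    have "E `` {u} \<subseteq> (\<lambda>e. \<phi> e x) ` D"
    proof
      fix v assume "v \<in> E `` {u}"
      then obtain y d' e where "u = \<phi> d' y" "v = \<phi> e y" "y \<in> C" "d' \<in> D" "e \<in> D"
        unfolding E_def by blast
      moreover have "x = y" using disj[of x y d d'] dx calculation by simp
      ultimately show "v \<in> (\<lambda>e. \<phi> e x) ` D" by blast
    qed
    then show ?thesis using D finite_subset by blast
  next
    case False
    then have "E `` {u} = {}" unfolding E_def P_def by auto
    then show ?thesis by simp
  qed
  ultimately show "finite_tiling P E" unfolding finite_tiling_def using P by blast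
  have "disjoint_family_on (\<lambda>d. \<phi> d ` C) D"
    unfolding disjoint_family_on_def using disj by blast
  then have "measure M P = (\<Sum>d\<in>D. measure M (\<phi> d ` C))"
    unfolding P_def using D C by (intro finite_measure_finite_Union) (auto intro: sets_act_image)
  also have "\<dots> = (\<Sum>d\<in>D. measure M C)"
    using D C by (intro sum.cong measure_act_image) auto
  finally show "measure M P = real (card D) * measure M C" by simp
qed

lemma measure_Union_translates_le:
  assumes "finite H" "H \<subseteq> carrier G" "C \<in> sets M"
  shows "measure M (\<Union>h\<in>H. \<phi> h ` C) \<le> real (card H) * measure M C"
proof -
  have "measure M (\<Union>h\<in>H. \<phi> h ` C) \<le> (\<Sum>h\<in>H. measure M (\<phi> h ` C))"
    using assms by (intro finite_measure_subadditive_finite) (auto intro: sets_act_image)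
  also have "\<dots> = (\<Sum>h\<in>H. measure M C)"
    using assms by (intro sum.cong measure_act_image) auto
  finally show ?thesis by simp
qed

text \<open>The local form of the Ornstein-Weiss theorem. The tiles are the intersections of \<open>Y\<close> with translates \<open>F x\<close> of a
  Folner set. Cut edges come only from the boundary of \<open>F\<close>, which has size at most
  \<open>\<delta> * card F\<close> per direction, whereas the tile has at least \<open>measure M Y / 2 * card F\<close> points. As \<open>F\<close> may depend on \<open>Y\<close>,
  the choice \<open>\<delta> = \<epsilon> * measure M Y / 4\<close> makes the cut small relative to the tile, and no quasi-tiling by sets of several
  shapes is needed.\<close>

lemma exists_tiling_with_small_cut:
  assumes folner: "folner G" and K: "finite K" "K \<subseteq> carrier G" and \<epsilon>: "0 < \<epsilon>"
    and Y: "Y \<in> sets M" "0 < measure M Y"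
  shows "\<exists>P E. finite_tiling P E \<and> P \<subseteq> Y \<and> 0 < measure M P \<and>
           (\<forall>k\<in>K. measure M (cut Y k P E) \<le> \<epsilon> * measure M P)"
proof -
  \<comment> \<open>A cut edge can enter or leave its tile, and tiles may fill only half of the average proportion: hence the 4.\<close>
  define \<delta> where "\<delta> = \<epsilon> * measure M Y / 4"
  have \<delta>: "0 < \<delta>" unfolding \<delta>_def using \<epsilon> Y by simp
  let ?K = "K \<union> m_inv G ` K"
  obtain F where F: "finite F" "F \<noteq> {}" "F \<subseteq> carrier G"
    and small: "\<forall>k\<in>?K. real (card {d \<in> F. k \<otimes> d \<notin> F}) \<le> \<delta> * real (card F)"
    using folner[unfolded folner_def, rule_format, of ?K \<delta>] K \<delta> by auto
  obtain D Z where D: "D \<subseteq> F" "measure M Y / 2 * real (card F) \<le> real (card D)"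
    and Z: "Z \<in> sets M" "Z \<subseteq> free_part" "0 < measure M Z" "\<forall>x\<in>Z. {d \<in> F. \<phi> d x \<in> Y} = D"
    using exists_large_return_set[OF F Y] by (elim exE conjE)
  have finD: "finite D" "D \<subseteq> carrier G" using D F finite_subset by auto
  \<comment> \<open>If translates of \<open>C\<close> by these quotients avoid \<open>C\<close>, then different tiles are disjoint.\<close>
  let ?L = "(\<lambda>(d, e). inv d \<otimes> e) ` (D \<times> D) - {\<one>}"
  have "finite ?L" "?L \<subseteq> carrier G - {\<one>}" using finD by auto
  then have "\<exists>C\<in>sets M. C \<subseteq> Z \<and> 0 < measure M C \<and> (\<forall>g\<in>?L. \<forall>x\<in>C. \<phi> g x \<notin> C)"
    using Z(1-3) by (rule exists_disjoint_translates)
  then obtain C where C: "C \<in> sets M" "C \<subseteq> Z" "0 < measure M C" "\<forall>g\<in>?L. \<forall>x\<in>C. \<phi> g x \<notin> C"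
    by (elim bexE conjE)
  have CX: "x \<in> space M" if "x \<in> C" for x using sets.sets_into_space[OF C(1)] that by blast
  have disj: "x = y \<and> d = e" if xy: "x \<in> C" "y \<in> C" "d \<in> D" "e \<in> D" "\<phi> d x = \<phi> e y" for x y d e
  proof -
    have de: "d \<in> carrier G" "e \<in> carrier G" using xy finD by auto
    have "\<phi> (inv d \<otimes> e) y = \<phi> (inv d) (\<phi> e y)" using CX xy de by (intro act_mult[symmetric]) auto
    also have "\<dots> = x" using CX xy de by (simp flip: xy(5))
    finally have eq: "\<phi> (inv d \<otimes> e) y = x" .
    then have "inv d \<otimes> e \<notin> ?L" using C(4) xy by auto
    then have "inv d \<otimes> e = \<one>" using xy by auto
    then have "d = e" using de by (metis inv_closed inv_equality inv_inv)
    then show ?thesis using eq \<open>inv d \<otimes> e = \<one>\<close> CX xy by auto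
  qed
  define P where "P = (\<Union>d\<in>D. \<phi> d ` C)"
  define E where "E = {(\<phi> d x, \<phi> e x) | x d e. x \<in> C \<and> d \<in> D \<and> e \<in> D}"
  have tiling: "finite_tiling P E" and measP: "measure M P = real (card D) * measure M C"
    using tiling_of_disjoint_translates[OF finD C(1) disj, folded P_def E_def] by blast+
  have C_D: "{d \<in> F. \<phi> d x \<in> Y} = D" if "x \<in> C" for x using that C(2) Z(4) by blast
  have "P \<subseteq> Y" unfolding P_def using C_D by blast
  have "0 < card D"
  proof -
    have "0 < measure M Y / 2 * real (card F)" using Y F by (simp add: card_gt_0_iff)
    then show ?thesis using D(2) by linarith
  qed
  then have "0 < measure M P" using measP C(3) by simp
  have "measure M (cut Y k P E) \<le> \<epsilon> * measure M P" if k: "k \<in> K" for k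
  proof -
    have kG: "k \<in> carrier G" using k K by blast
    let ?H1 = "{d \<in> F. k \<otimes> d \<notin> F}" and ?H2 = "{d \<in> F. inv k \<otimes> d \<notin> F}"
    let ?H2' = "(\<lambda>d. inv k \<otimes> d) ` ?H2"
    have "cut Y k P E \<subseteq> (\<Union>h\<in>?H1. \<phi> h ` C) \<union> (\<Union>h\<in>?H2'. \<phi> h ` C)"
    proof
      fix y assume y: "y \<in> cut Y k P E"
      then have yY: "y \<in> Y" "\<phi> k y \<in> Y" "(y, \<phi> k y) \<notin> E" "y \<in> P \<or> \<phi> k y \<in> P"
        unfolding cut_def by auto
      have yX: "y \<in> space M" using yY(1) sets.sets_into_space[OF Y(1)] by blast
      from yY(4) show "y \<in> (\<Union>h\<in>?H1. \<phi> h ` C) \<union> (\<Union>h\<in>?H2'. \<phi> h ` C)"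
      proof
        assume "y \<in> P"
        then obtain d x where dx: "d \<in> D" "x \<in> C" "y = \<phi> d x" unfolding P_def by blast
        have ky: "\<phi> k y = \<phi> (k \<otimes> d) x" using dx CX kG finD by (simp add: act_mult subset_iff)
        have "k \<otimes> d \<notin> D" using yY(3) dx unfolding E_def ky by blast
        then have "k \<otimes> d \<notin> F" using C_D[OF dx(2)] yY(2) unfolding ky by blast
        then show ?thesis using dx D(1) by blast
      next
        assume "\<phi> k y \<in> P"
        then obtain d x where dx: "d \<in> D" "x \<in> C" "\<phi> k y = \<phi> d x" unfolding P_def by blast
        have "y = \<phi> (inv k) (\<phi> k y)" using yX kG by simp
        also have "\<dots> = \<phi> (inv k \<otimes> d) x" using dx CX kG finD by (simp add: act_mult subset_iff)
        finally have y': "y = \<phi> (inv k \<otimes> d) x" .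
        have "inv k \<otimes> d \<notin> D"
          using yY(3) dx(1,2) unfolding E_def dx(3) by (subst (asm) y') blast
        then have "inv k \<otimes> d \<notin> F" using C_D[OF dx(2)] yY(1) y' by blast
        then show ?thesis using dx(1,2) D(1) y' by blast
      qed
    qed
    moreover have "(\<Union>h\<in>?H1. \<phi> h ` C) \<union> (\<Union>h\<in>?H2'. \<phi> h ` C) \<in> sets M"
      using F C kG by (intro sets.Un sets.finite_UN sets_act_image) auto
    ultimately have "measure M (cut Y k P E) \<le> measure M ((\<Union>h\<in>?H1. \<phi> h ` C) \<union> (\<Union>h\<in>?H2'. \<phi> h ` C))"
      by (intro finite_measure_mono)
    also have "\<dots> \<le> measure M (\<Union>h\<in>?H1. \<phi> h ` C) + measure M (\<Union>h\<in>?H2'. \<phi> h ` C)"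
      using F C kG by (intro measure_Un_le sets.finite_UN sets_act_image) auto
    also have "\<dots> \<le> real (card ?H1) * measure M C + real (card ?H2') * measure M C"
      using F C kG by (intro add_mono measure_Union_translates_le) auto
    also have "\<dots> \<le> (\<delta> * real (card F)) * measure M C + (\<delta> * real (card F)) * measure M C"
    proof (intro add_mono mult_right_mono measure_nonneg)
      show "real (card ?H1) \<le> \<delta> * real (card F)" using small k by blast
      have "real (card ?H2') \<le> real (card ?H2)" using F by (simp add: card_image_le)
      also have "\<dots> \<le> \<delta> * real (card F)" using small k by blast
      finally show "real (card ?H2') \<le> \<delta> * real (card F)" .
    qed
    also have "\<dots> = \<epsilon> * (measure M Y / 2 * real (card F)) * measure M C"
      unfolding \<delta>_def by simp
    also have "\<dots> \<le> \<epsilon> * real (card D) * measure M C"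
      using D(2) \<epsilon> by (intro mult_right_mono mult_left_mono) auto
    finally show ?thesis unfolding measP by simp
  qed
  then show ?thesis using tiling \<open>P \<subseteq> Y\<close> \<open>0 < measure M P\<close> by blast
qed

lemma finite_tiling_Un:
  assumes PE: "finite_tiling P E" and QF: "finite_tiling Q F" and disj: "P \<inter> Q = {}"
  shows "finite_tiling (P \<union> Q) (E \<union> F)"
proof -
  have E: "equiv P E" "E \<subseteq> P \<times> P" and F: "equiv Q F" "F \<subseteq> Q \<times> Q"
    using PE QF unfolding finite_tiling_def by (auto dest: equiv_type)
  have "equiv (P \<union> Q) (E \<union> F)"
  proof (rule equivI)
    show "refl_on (P \<union> Q) (E \<union> F)"
      using E(1) F(1) unfolding equiv_def by (blast intro: refl_on_Un)
    show "sym (E \<union> F)" using E(1) F(1) by (intro sym_Un) (auto simp: equiv_def)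
    show "trans (E \<union> F)"
    proof (rule transI)
      fix x y z assume xy: "(x, y) \<in> E \<union> F" and yz: "(y, z) \<in> E \<union> F"
      have tr: "trans E" "trans F" using E(1) F(1) by (auto simp: equiv_def)
      from xy yz E(2) F(2) disj have "(x, y) \<in> E \<and> (y, z) \<in> E \<or> (x, y) \<in> F \<and> (y, z) \<in> F" by blast
      then show "(x, z) \<in> E \<union> F" using tr by (meson UnI1 UnI2 transD)
    qed
    show "E \<union> F \<subseteq> (P \<union> Q) \<times> (P \<union> Q)" using E(2) F(2) by blast
  qed
  then show ?thesis using PE QF unfolding finite_tiling_def by (auto simp: Un_Image)
qed

text \<open>New tiles are added, and old tiles stay as they are.\<close>

definition extends :: "'x set \<times> 'x rel \<Rightarrow> 'x set \<times> 'x rel \<Rightarrow> bool" where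
  "extends = (\<lambda>(P, E) (Q, F). P \<subseteq> Q \<and> E \<subseteq> F \<and> (\<forall>x\<in>P. F `` {x} = E `` {x}))"

lemma extends_mono:
  assumes "\<And>n. extends (P n, E n) (P (Suc n), E (Suc n))" "m \<le> n"
  shows "extends (P m, E m) (P n, E n)"
  using assms(2)
proof (induction n rule: dec_induct)
  case base
  show ?case unfolding extends_def by auto
next
  case (step n)
  then show ?case using assms(1)[of n] unfolding extends_def by blast
qed

lemma finite_tiling_UN:
  assumes tilings: "\<And>n. finite_tiling (P n) (E n)"
    and ext: "\<And>n. extends (P n, E n) (P (Suc n), E (Suc n))"
  shows "finite_tiling (\<Union>n. P n) (\<Union>n. E n)" and "extends (P m, E m) (\<Union>n. P n, \<Union>n. E n)"
proof -
  note ext' = extends_mono[of P E, OF ext]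
  have equiv: "equiv (P n) (E n)" and type: "E n \<subseteq> P n \<times> P n" for n
    using tilings[of n] unfolding finite_tiling_def by (auto dest: equiv_type)
  have same: "(x, y) \<in> E m" if "x \<in> P m" "(x, y) \<in> E n" for x y m n
  proof (cases "m \<le> n")
    case True
    then show ?thesis using ext'[OF True] that unfolding extends_def by blast
  next
    case False
    then have "n \<le> m" by simp
    from ext'[OF this] that(2) show ?thesis unfolding extends_def by blast
  qed
  show "extends (P m, E m) (\<Union>n. P n, \<Union>n. E n)"
    unfolding extends_def using same by blast
  have "equiv (\<Union>n. P n) (\<Union>n. E n)"
  proof (rule equivI)
    show "refl_on (\<Union>n. P n) (\<Union>n. E n)"
      using equiv unfolding equiv_def refl_on_def by blast
    show "sym (\<Union>n. E n)" using equiv unfolding equiv_def sym_def by blast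
    show "trans (\<Union>n. E n)"
    proof (rule transI)
      fix x y z assume "(x, y) \<in> (\<Union>n. E n)" "(y, z) \<in> (\<Union>n. E n)"
      then obtain m n where mn: "(x, y) \<in> E m" "(y, z) \<in> E n" by blast
      then have "(y, z) \<in> E m" using same[of y m z n] type[of m] by blast
      then have "(x, z) \<in> E m" using equiv[of m] mn(1) unfolding equiv_def by (meson transD)
      then show "(x, z) \<in> (\<Union>n. E n)" by blast
    qed
    show "(\<Union>n. E n) \<subseteq> (\<Union>n. P n) \<times> (\<Union>n. P n)" using type by blast
  qed
  moreover have "finite ((\<Union>n. E n) `` {x})" for x
  proof (cases "x \<in> (\<Union>n. P n)")
    case True
    then obtain m where "x \<in> P m" by blast
    then have "(\<Union>n. E n) `` {x} \<subseteq> E m `` {x}" using same by blast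
    then show ?thesis using tilings[of m] finite_subset unfolding finite_tiling_def by blast
  next
    case False
    then have "(\<Union>n. E n) `` {x} = {}" using type by blast
    then show ?thesis by simp
  qed
  moreover have "(\<Union>n. P n) \<in> sets M" "(\<Union>n. E n) \<in> sets (M \<Otimes>\<^sub>M M)"
    using tilings unfolding finite_tiling_def by auto
  moreover have "(\<Union>n. E n) \<subseteq> orbit_rel G M \<phi>" using tilings unfolding finite_tiling_def by blast
  ultimately show "finite_tiling (\<Union>n. P n) (\<Union>n. E n)" unfolding finite_tiling_def by blast
qed

text \<open>An edge that is cut once remains cut, because its end in a tile keeps that tile. So the cuts increase along the sequence
  and the bound passes to the limit.\<close>

lemma measure_cut_UN_le:
  assumes tilings: "\<And>n. finite_tiling (P n) (E n)"
    and ext: "\<And>n. extends (P n, E n) (P (Suc n), E (Suc n))"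
    and k: "k \<in> carrier G"
    and small: "\<And>n. measure M (cut (space M) k (P n) (E n)) \<le> \<epsilon> * measure M (P n)"
  shows "measure M (cut (space M) k (\<Union>n. P n) (\<Union>n. E n)) \<le> \<epsilon> * measure M (\<Union>n. P n)"
proof -
  let ?cut = "\<lambda>n. cut (space M) k (P n) (E n)"
  have P: "P n \<in> sets M" and equiv: "equiv (P n) (E n)" and type: "E n \<subseteq> P n \<times> P n"
    and E: "E n \<in> sets (M \<Otimes>\<^sub>M M)" for n
    using tilings[of n] unfolding finite_tiling_def by (auto dest: equiv_type)
  have mono: "?cut n \<subseteq> cut (space M) k Q F" if "extends (P n, E n) (Q, F)" "finite_tiling Q F" for n Q F
  proof
    fix x assume x: "x \<in> ?cut n"
    have symF: "sym F" and symE: "sym (E n)"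
      using that(2) equiv[of n] unfolding finite_tiling_def equiv_def by auto
    have "(x, \<phi> k x) \<notin> F"
    proof
      assume F: "(x, \<phi> k x) \<in> F"
      have "(x, \<phi> k x) \<in> E n"
      proof (cases "x \<in> P n")
        case True
        then show ?thesis using that(1) F unfolding extends_def by blast
      next
        case False
        then have "\<phi> k x \<in> P n" using x unfolding cut_def by blast
        then have "(\<phi> k x, x) \<in> E n" using that(1) symD[OF symF F] unfolding extends_def by blast
        then show ?thesis by (rule symD[OF symE])
      qed
      then show False using x unfolding cut_def by blast
    qed
    then show "x \<in> cut (space M) k Q F" using x that(1) unfolding cut_def extends_def by blast
  qed
  have "incseq ?cut" by (intro incseq_SucI mono ext tilings)
  moreover have "cut (space M) k (\<Union>n. P n) (\<Union>n. E n) = (\<Union>n. ?cut n)"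
  proof
    show "(\<Union>n. ?cut n) \<subseteq> cut (space M) k (\<Union>n. P n) (\<Union>n. E n)"
      using mono[OF finite_tiling_UN(2)[of P E, OF tilings ext] finite_tiling_UN(1)[of P E, OF tilings ext]] by blast
    show "cut (space M) k (\<Union>n. P n) (\<Union>n. E n) \<subseteq> (\<Union>n. ?cut n)"
      unfolding cut_def by blast
  qed
  moreover have "range ?cut \<subseteq> sets M" using sets_cut P E k by auto
  ultimately have "(\<lambda>n. measure M (?cut n)) \<longlonglongrightarrow> measure M (cut (space M) k (\<Union>n. P n) (\<Union>n. E n))"
    using finite_Lim_measure_incseq[of ?cut] by simp
  moreover have "(\<lambda>n. measure M (P n)) \<longlonglongrightarrow> measure M (\<Union>n. P n)"
    using P ext by (intro finite_Lim_measure_incseq incseq_SucI) (auto simp: extends_def)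
  then have "(\<lambda>n. \<epsilon> * measure M (P n)) \<longlonglongrightarrow> \<epsilon> * measure M (\<Union>n. P n)"
    by (intro tendsto_mult_left)
  ultimately show ?thesis using small by (intro LIMSEQ_le) auto
qed

text \<open>A tiling that is maximal among those with small cut covers almost everything, since otherwise the untiled
  rest could be partly tiled. Every cut edge is counted at the tile that was placed first,
  so the proportion \<open>\<epsilon>\<close> is the same for the combined tiling.\<close>

lemma exists_finite_subrelation:
  assumes folner: "folner G" and K: "finite K" "K \<subseteq> carrier G" and \<epsilon>: "0 < \<epsilon>"
  shows "\<exists>E. subequiv_rel M (orbit_rel G M \<phi>) E \<and> (\<forall>x. finite (E `` {x})) \<and>
           (\<forall>k\<in>K. measure M {x \<in> space M. (x, \<phi> k x) \<notin> E} \<le> \<epsilon>)"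
proof -
  define X where "X = {(P, E). finite_tiling P E \<and>
      (\<forall>k\<in>K. measure M (cut (space M) k P E) \<le> \<epsilon> * measure M P)}"
  have "\<exists>a\<in>X. \<forall>b\<in>X. extends a b \<longrightarrow> measure M (fst b) \<le> measure M (fst a)"
  proof (rule exists_maximal_by_exhaustion[where c = 1])
    show "({}, {}) \<in> X"
      unfolding X_def finite_tiling_def cut_def by (auto simp: equiv_def refl_on_def sym_def trans_def)
    show "extends a a" for a unfolding extends_def by (cases a) auto
    show "extends a c" if "extends a b" "extends b c" for a b c
    proof (cases a; cases b; cases c)
      fix P E Q F S H assume "a = (P, E)" "b = (Q, F)" "c = (S, H)"
      with that have "P \<subseteq> Q" "E \<subseteq> F" "\<forall>x\<in>P. F `` {x} = E `` {x}"
        "Q \<subseteq> S" "F \<subseteq> H" "\<forall>x\<in>Q. H `` {x} = F `` {x}"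
        unfolding extends_def by auto
      then show ?thesis unfolding extends_def \<open>a = (P, E)\<close> \<open>c = (S, H)\<close> by (simp add: subset_iff)
    qed
    show "measure M (fst a) \<le> measure M (fst b)" if "a \<in> X" "b \<in> X" "extends a b" for a b
      using that by (intro finite_measure_mono) (auto simp: extends_def X_def finite_tiling_def)
    show "measure M (fst a) \<le> 1" for a :: "'x set \<times> 'x rel" by (rule prob_le_1)
    fix s assume s: "\<And>n :: nat. s n \<in> X" "\<And>n. extends (s n) (s (Suc n))"
    define P where "P n = fst (s n)" for n
    define E where "E n = snd (s n)" for n
    have PE: "s n = (P n, E n)" for n unfolding P_def E_def by simp
    have tilings: "finite_tiling (P n) (E n)"
      and small: "\<And>k. k \<in> K \<Longrightarrow> measure M (cut (space M) k (P n) (E n)) \<le> \<epsilon> * measure M (P n)" for n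
      using s(1)[of n] unfolding PE X_def by auto
    have ext: "extends (P n, E n) (P (Suc n), E (Suc n))" for n using s(2)[of n] unfolding PE .
    show "\<exists>u\<in>X. \<forall>n. extends (s n) u"
    proof (intro bexI[of _ "(\<Union>n. P n, \<Union>n. E n)"] allI)
      show "extends (s n) (\<Union>n. P n, \<Union>n. E n)" for n
        unfolding PE using tilings ext by (rule finite_tiling_UN(2))
      show "(\<Union>n. P n, \<Union>n. E n) \<in> X"
        unfolding X_def using finite_tiling_UN(1)[of P E, OF tilings ext] measure_cut_UN_le[of P E, OF tilings ext] small K(2)
        by auto
    qed
  qed
  then obtain P E where PE: "(P, E) \<in> X"
    and max: "\<And>Q F. (Q, F) \<in> X \<Longrightarrow> extends (P, E) (Q, F) \<Longrightarrow> measure M Q \<le> measure M P"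
    by (metis fst_conv surj_pair)
  have tiling: "finite_tiling P E" and small: "\<And>k. k \<in> K \<Longrightarrow> measure M (cut (space M) k P E) \<le> \<epsilon> * measure M P"
    using PE unfolding X_def by auto
  have P: "P \<in> sets M" and type: "E \<subseteq> P \<times> P"
    using tiling unfolding finite_tiling_def by (auto dest: equiv_type)
  let ?Y = "space M - P"
  have Y: "?Y \<in> sets M" using P by simp
  have null: "measure M ?Y = 0"
  proof (rule ccontr)
    assume "measure M ?Y \<noteq> 0"
    then have "0 < measure M ?Y" by (simp add: zero_less_measure_iff)
    then obtain Q F where QF: "finite_tiling Q F" "Q \<subseteq> ?Y" "0 < measure M Q"
      and smallQ: "\<forall>k\<in>K. measure M (cut ?Y k Q F) \<le> \<epsilon> * measure M Q"
      using exists_tiling_with_small_cut[OF folner K \<epsilon> Y] by blast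
    have Q: "Q \<in> sets M" and typeF: "F \<subseteq> Q \<times> Q" and F: "F \<in> sets (M \<Otimes>\<^sub>M M)"
      using QF(1) unfolding finite_tiling_def by (auto dest: equiv_type)
    have disj: "P \<inter> Q = {}" using QF(2) by blast
    have meas: "measure M (P \<union> Q) = measure M P + measure M Q"
      using P Q disj by (rule finite_measure_Union)
    have "measure M (cut (space M) k (P \<union> Q) (E \<union> F)) \<le> \<epsilon> * measure M (P \<union> Q)" if k: "k \<in> K" for k
    proof -
      have kG: "k \<in> carrier G" using k K by blast
      have sets: "cut (space M) k P E \<in> sets M" "cut ?Y k Q F \<in> sets M"
        using tiling F Q kG Y unfolding finite_tiling_def by (auto intro!: sets_cut)
      \<comment> \<open>An edge that does not touch \<open>P\<close> lies inside \<open>?Y\<close>.\<close>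
      have "cut (space M) k (P \<union> Q) (E \<union> F) \<subseteq> cut (space M) k P E \<union> cut ?Y k Q F"
        unfolding cut_def by blast
      then have "measure M (cut (space M) k (P \<union> Q) (E \<union> F)) \<le> measure M (cut (space M) k P E \<union> cut ?Y k Q F)"
        using sets by (intro finite_measure_mono) auto
      also have "\<dots> \<le> measure M (cut (space M) k P E) + measure M (cut ?Y k Q F)"
        using sets by (intro measure_Un_le)
      also have "\<dots> \<le> \<epsilon> * measure M P + \<epsilon> * measure M Q"
        using small[OF k] bspec[OF smallQ k] by (rule add_mono)
      finally show ?thesis unfolding meas by (simp add: distrib_left)
    qed
    then have "(P \<union> Q, E \<union> F) \<in> X"
      unfolding X_def using finite_tiling_Un[OF tiling QF(1) disj] by blast
    moreover have "extends (P, E) (P \<union> Q, E \<union> F)"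
      unfolding extends_def using typeF disj by blast
    ultimately have "measure M (P \<union> Q) \<le> measure M P" by (rule max)
    then show False using meas QF(3) by simp
  qed
  \<comment> \<open>The remaining null set is completed by trivial classes, which makes the relation reflexive on the whole space.\<close>
  define I where "I = {(x, x) | x. x \<in> ?Y}"
  have I_eq: "I = {p \<in> space (M \<Otimes>\<^sub>M M). fst p = snd p} \<inter> (?Y \<times> space M)"
    unfolding I_def by (auto simp: space_pair_measure)
  have "finite_tiling ?Y I"
    unfolding finite_tiling_def
  proof (intro conjI allI)
    show "I \<in> sets (M \<Otimes>\<^sub>M M)"
      unfolding I_eq using Y separated by (intro sets.Int sets_diagonal pair_measureI) auto
    show "I \<subseteq> orbit_rel G M \<phi>"
      unfolding I_def using in_orbit_relI[of _ \<one>] by auto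
    show "equiv ?Y I" unfolding I_def by (rule equivI) (auto intro!: refl_onI symI transI)
    show "finite (I `` {x})" for x
      by (rule finite_subset[of _ "{x}"]) (auto simp: I_def)
  qed (rule Y)
  then have full: "finite_tiling (P \<union> ?Y) (E \<union> I)"
    by (intro finite_tiling_Un tiling) auto
  have "P \<union> ?Y = space M" using sets.sets_into_space[OF P] by blast
  then have "subequiv_rel M (orbit_rel G M \<phi>) (E \<union> I)" and "\<forall>x. finite ((E \<union> I) `` {x})"
    using full unfolding finite_tiling_def subequiv_rel_def by auto
  moreover have "measure M {x \<in> space M. (x, \<phi> k x) \<notin> E \<union> I} \<le> \<epsilon>" if k: "k \<in> K" for k
  proof -
    have cut: "cut (space M) k P E \<in> sets M"
      using tiling k K unfolding finite_tiling_def by (auto intro!: sets_cut)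
    have "{x \<in> space M. (x, \<phi> k x) \<notin> E \<union> I} \<subseteq> cut (space M) k P E \<union> ?Y"
      using k K unfolding cut_def by auto
    then have "measure M {x \<in> space M. (x, \<phi> k x) \<notin> E \<union> I} \<le> measure M (cut (space M) k P E \<union> ?Y)"
      using cut Y by (intro finite_measure_mono) auto
    also have "\<dots> \<le> measure M (cut (space M) k P E) + measure M ?Y"
      using cut Y by (rule measure_Un_le)
    also have "\<dots> \<le> \<epsilon> * measure M P" using small[OF k] null by simp
    also have "\<dots> \<le> \<epsilon>" using \<epsilon> prob_le_1[of P] by (simp add: mult_le_cancel_left1)
    finally show ?thesis .
  qed
  ultimately show ?thesis by blast
qed

text \<open>The Ornstein-Weiss theorem for free probability-measure-preserving actions. By Borel-Cantelli, finite
  relations that miss each group element with summable error eventually contain almost every edge.\<close>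

theorem hyperfinite_orbit_rel:
  assumes folner: "folner G"
  shows "hyperfinite M (orbit_rel G M \<phi>)"
proof -
  let ?R = "orbit_rel G M \<phi>"
  define g where "g = from_nat_into (carrier G)"
  have g: "g n \<in> carrier G" for n
    unfolding g_def using one_closed by (intro from_nat_into) blast
  have "\<exists>E. subequiv_rel M ?R E \<and> (\<forall>x. finite (E `` {x})) \<and>
           (\<forall>k\<in>g ` {..n}. measure M {x \<in> space M. (x, \<phi> k x) \<notin> E} \<le> (1 / 2) ^ n)" for n :: nat
    using g by (intro exists_finite_subrelation folner) auto
  then have "\<exists>E. \<forall>n. subequiv_rel M ?R (E n) \<and> (\<forall>x. finite (E n `` {x})) \<and>
           (\<forall>k\<in>g ` {..n}. measure M {x \<in> space M. (x, \<phi> k x) \<notin> E n} \<le> (1 / 2) ^ n)"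
    by (intro choice allI)
  then obtain E where E: "\<forall>n. subequiv_rel M ?R (E n) \<and> (\<forall>x. finite (E n `` {x})) \<and>
           (\<forall>k\<in>g ` {..n}. measure M {x \<in> space M. (x, \<phi> k x) \<notin> E n} \<le> (1 / 2) ^ n)" ..
  have sub: "subequiv_rel M ?R (E n)" and fin: "finite (E n `` {x})" for n x
    using E by blast+
  have small: "measure M {x \<in> space M. (x, \<phi> (g i) x) \<notin> E n} \<le> (1 / 2) ^ n" if "i \<le> n" for n i
    using E that by blast
  have E_sets: "E n \<in> sets (M \<Otimes>\<^sub>M M)" and E_sub: "E n \<subseteq> ?R" and E_equiv: "equiv (space M) (E n)" for n
    using sub[of n] unfolding subequiv_rel_def by auto
  \<comment> \<open>The approximations need not increase, but their tail intersections do.\<close>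
  define T where "T n = (\<Inter>m\<in>{n..}. E m)" for n
  have "incseq T" unfolding T_def by (intro monoI) force
  moreover have "subequiv_rel M ?R (T n)" for n
    unfolding subequiv_rel_def
  proof (intro conjI)
    show "T n \<in> sets (M \<Otimes>\<^sub>M M)" unfolding T_def using E_sets by (intro sets.countable_INT') auto
    show "T n \<subseteq> ?R" unfolding T_def using E_sub[of n] by auto
    show "equiv (space M) (T n)"
    proof (rule equivI)
      show "refl_on (space M) (T n)"
        using E_equiv unfolding T_def equiv_def refl_on_def by blast
      show "sym (T n)" using E_equiv unfolding T_def equiv_def sym_def by blast
      show "trans (T n)" using E_equiv unfolding T_def equiv_def trans_def by blast
      show "T n \<subseteq> space M \<times> space M" using equiv_type[OF E_equiv[of n]] unfolding T_def by auto
    qed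
  qed
  moreover have "finite (T n `` {x})" for n x
    by (rule finite_subset[OF _ fin[of n x]]) (auto simp: T_def)
  moreover have "eq_mod_null M ?R (\<Union>n. T n)"
  proof -
    have T_sets: "(\<Union>n. T n) \<in> sets (M \<Otimes>\<^sub>M M)"
      unfolding T_def using E_sets by (intro sets.countable_UN' sets.countable_INT') auto
    have "(\<Union>n. T n) \<subseteq> ?R" using E_sub unfolding T_def by blast
    then have "(?R - (\<Union>n. T n)) \<union> ((\<Union>n. T n) - ?R) = ?R - (\<Union>n. T n)" by blast
    moreover have "AE x in M. (x, \<phi> h x) \<notin> ?R - (\<Union>n. T n)" if h: "h \<in> carrier G" for h
    proof -
      obtain i where i: "h = g i"
        using from_nat_into_surj[OF countable_group h] unfolding g_def by metis
      let ?B = "\<lambda>n. {x \<in> space M. (x, \<phi> h x) \<notin> E (n + i)}"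
      have B: "?B n \<in> sets M" for n
      proof -
        have "?B n = space M - {x \<in> space M. (x, \<phi> h x) \<in> E (n + i)}" by blast
        then show ?thesis using sets_in_rel1[OF E_sets h] by simp
      qed
      have "summable (\<lambda>n. measure M (?B n))"
      proof (rule summable_comparison_test')
        show "summable (\<lambda>n. (1 / 2 :: real) ^ n)" by (intro summable_geometric) simp
        show "norm (measure M (?B n)) \<le> (1 / 2) ^ n" for n
        proof -
          have "measure M (?B n) \<le> (1 / 2) ^ (n + i)" using small[of i "n + i"] i by simp
          also have "\<dots> \<le> (1 / 2) ^ n" by (intro power_decreasing) auto
          finally show ?thesis by simp
        qed
      qed
      then have "AE x in M. eventually (\<lambda>n. x \<in> space M - ?B n) sequentially"
        using B by (intro borel_cantelli_AE1) (auto simp: emeasure_eq_measure)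
      then show ?thesis
      proof eventually_elim
        case (elim x)
        then obtain N where "\<forall>n\<ge>N. x \<in> space M - ?B n" unfolding eventually_sequentially by blast
        then have N: "(x, \<phi> h x) \<in> E (n + i)" if "n \<ge> N" for n using that by blast
        have "(x, \<phi> h x) \<in> E m" if "m \<ge> N + i" for m using N[of "m - i"] that by simp
        then have "(x, \<phi> h x) \<in> T (N + i)" unfolding T_def by blast
        then show ?case by blast
      qed
    qed
    ultimately show ?thesis
      unfolding eq_mod_null_def using rel_measure_eq_0_iff[of "?R - (\<Union>n. T n)"] sets_orbit_rel T_sets by auto
  qed
  ultimately show ?thesis unfolding hyperfinite_def by blast
qed

end

section \<open>Amenability of groups acting inside a hyperfinite relation\<close>

context free_countable_pmp_action
begin

lemma inj_on_act_free: "x \<in> free_part \<Longrightarrow> inj_on (\<lambda>g. \<phi> g x) (carrier G)"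
  by (intro inj_onI) (rule free_part_act)

lemma aperiodic_orbit_rel:
  assumes "infinite (carrier G)"
  shows "aperiodic M (orbit_rel G M \<phi>)"
  unfolding aperiodic_def using AE_free_part
proof eventually_elim
  case (elim x)
  have "x \<in> space M" using elim unfolding free_part_def by blast
  then have "orbit_rel G M \<phi> `` {x} = (\<lambda>g. \<phi> g x) ` carrier G"
    unfolding orbit_rel_def by auto
  then show ?case using assms inj_on_act_free[OF elim] by (simp add: finite_image_iff)
qed

text \<open>The inverse makes the return sets transform by left translation when the base point moves along its class.\<close>

definition returns :: "'x rel \<Rightarrow> 'a set \<Rightarrow> 'x \<Rightarrow> 'a set" where
  "returns T S x = {b \<in> S. (x, \<phi> (inv b) x) \<in> T}"

lemma finite_returns:
  assumes "finite (T `` {x})" "x \<in> free_part" "S \<subseteq> carrier G"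
  shows "finite (returns T S x)"
proof -
  have "inj_on (\<lambda>b. \<phi> (inv b) x) S"
  proof (rule inj_onI)
    fix a b assume "a \<in> S" "b \<in> S" "\<phi> (inv a) x = \<phi> (inv b) x"
    then have "inv a = inv b" using assms by (intro free_part_act[of x]) auto
    then show "a = b" using \<open>a \<in> S\<close> \<open>b \<in> S\<close> assms(3) by (metis inv_inv subsetD)
  qed
  then have "inj_on (\<lambda>b. \<phi> (inv b) x) (returns T S x)"
    by (rule inj_on_subset) (auto simp: returns_def)
  moreover have "(\<lambda>b. \<phi> (inv b) x) ` returns T S x \<subseteq> T `` {x}"
    unfolding returns_def by auto
  ultimately show ?thesis using assms(1) by (metis finite_imageD finite_subset)
qed

lemma measurable_card_returns:
  assumes T: "T \<in> sets (M \<Otimes>\<^sub>M M)" and S: "S \<subseteq> carrier G"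
  shows "(\<lambda>x. real (card (returns T S x))) \<in> borel_measurable M"
proof -
  let ?c = "to_nat_on (carrier G)"
  have inj: "inj_on ?c (carrier G)" using countable_group by (rule inj_on_to_nat_on)
  have "(\<lambda>x. card (?c ` returns T S x)) \<in> measurable M (count_space UNIV)"
  proof (rule measurable_card)
    fix i
    show "{x \<in> space M. i \<in> ?c ` returns T S x} \<in> sets M"
    proof (cases "i \<in> ?c ` S")
      case True
      then obtain b where b: "b \<in> S" "i = ?c b" by blast
      then have "{x \<in> space M. i \<in> ?c ` returns T S x} = {x \<in> space M. (x, \<phi> (inv b) x) \<in> T}"
        using inj S unfolding returns_def by (auto dest: inj_onD)
      then show ?thesis using sets_in_rel1[OF T] b S by auto
    next
      case False
      then have never: "{x \<in> space M. i \<in> ?c ` returns T S x} = {}" unfolding returns_def by auto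
      show ?thesis unfolding never by simp
    qed
  qed
  moreover have "card (?c ` returns T S x) = card (returns T S x)" for x
    using inj S by (intro card_image) (auto simp: returns_def intro: inj_on_subset)
  ultimately have "(\<lambda>x. card (returns T S x)) \<in> measurable M (count_space UNIV)" by simp
  then show ?thesis by (rule measurable_compose) simp
qed

definition return_ratio :: "'x rel \<Rightarrow> 'a set \<Rightarrow> 'x \<Rightarrow> real" where
  "return_ratio T S x = real (card (returns T S x)) / real (card (returns T (carrier G) x))"

definition return_mean :: "'x rel \<Rightarrow> 'a set \<Rightarrow> real" where
  "return_mean T S = integral\<^sup>L M (return_ratio T S)"

lemma returns_translate:
  assumes T: "equiv (space M) T" and g: "g \<in> carrier G" and S: "S \<subseteq> carrier G"
    and x: "(x, \<phi> (inv g) x) \<in> T"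
  shows "returns T (g <# S) x = (\<lambda>b. g \<otimes> b) ` returns T S (\<phi> (inv g) x)"
proof -
  have xX: "x \<in> space M" using equiv_type[OF T] x by blast
  have "(x, \<phi> (inv (g \<otimes> b)) x) \<in> T \<longleftrightarrow> (\<phi> (inv g) x, \<phi> (inv b) (\<phi> (inv g) x)) \<in> T"
    if "b \<in> S" for b
  proof -
    have "\<phi> (inv (g \<otimes> b)) x = \<phi> (inv b) (\<phi> (inv g) x)"
      using that g S xX by (simp add: act_mult inv_mult_group subset_iff)
    then show ?thesis
      using T x unfolding equiv_def by (metis symD transD)
  qed
  then show ?thesis unfolding returns_def l_coset_def by auto
qed

text \<open>Moving the base point inside a class of \<open>T\<close> does not change the class, only its parametrisation by the group.\<close>

lemma return_ratio_translate:
  assumes T: "equiv (space M) T" and g: "g \<in> carrier G" and S: "S \<subseteq> carrier G"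
    and x: "(x, \<phi> (inv g) x) \<in> T"
  shows "return_ratio T (g <# S) x = return_ratio T S (\<phi> (inv g) x)"
proof -
  have card: "card (returns T (g <# U) x) = card (returns T U (\<phi> (inv g) x))" if U: "U \<subseteq> carrier G" for U
  proof -
    have "inj_on (\<lambda>b. g \<otimes> b) (returns T U (\<phi> (inv g) x))"
      using g U unfolding returns_def by (intro inj_onI) (auto simp: subset_iff)
    then show ?thesis unfolding returns_translate[OF T g U x] by (rule card_image)
  qed
  have "g <# carrier G = carrier G"
  proof (intro equalityI subsetI)
    fix h assume "h \<in> carrier G"
    then have "h = g \<otimes> (inv g \<otimes> h)" "inv g \<otimes> h \<in> carrier G"
      using g by (simp_all flip: m_assoc)
    then show "h \<in> g <# carrier G" unfolding l_coset_def by blast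
  qed (use g in \<open>auto simp: l_coset_def\<close>)
  then show ?thesis using card[OF S] card[of "carrier G"] unfolding return_ratio_def by simp
qed

context
  fixes T :: "'x rel"
  assumes T_sets: "T \<in> sets (M \<Otimes>\<^sub>M M)" and T_equiv: "equiv (space M) T"
    and T_fin: "\<And>x. x \<in> space M \<Longrightarrow> finite (T `` {x})"
begin

lemma finite_returns_free: "x \<in> free_part \<Longrightarrow> S \<subseteq> carrier G \<Longrightarrow> finite (returns T S x)"
  using T_fin by (intro finite_returns) (auto simp: free_part_def)

lemma return_ratio_nonneg: "0 \<le> return_ratio T S x"
  unfolding return_ratio_def by simp

lemma return_ratio_le_1:
  assumes "x \<in> free_part" "S \<subseteq> carrier G"
  shows "return_ratio T S x \<le> 1"
proof -
  have "card (returns T S x) \<le> card (returns T (carrier G) x)"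
    using assms by (intro card_mono finite_returns_free) (auto simp: returns_def)
  then show ?thesis
    unfolding return_ratio_def by (cases "card (returns T (carrier G) x) = 0") (auto simp: divide_le_eq_1)
qed

lemma integrable_return_ratio:
  assumes "S \<subseteq> carrier G"
  shows "integrable M (return_ratio T S)"
proof (rule integrable_const_bound[where B = 1])
  show "AE x in M. norm (return_ratio T S x) \<le> 1"
    using AE_free_part by eventually_elim (use return_ratio_nonneg return_ratio_le_1 assms in auto)
  show "return_ratio T S \<in> borel_measurable M"
    unfolding return_ratio_def using measurable_card_returns[OF T_sets] assms
    by (intro borel_measurable_divide) auto
qed

lemma return_mean_nonneg: "0 \<le> return_mean T S"
  unfolding return_mean_def using return_ratio_nonneg by (intro integral_nonneg_AE) auto

lemma return_mean_carrier: "return_mean T (carrier G) = 1"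
proof -
  have "AE x in M. return_ratio T (carrier G) x = 1"
    using AE_free_part
  proof eventually_elim
    case (elim x)
    have x: "x \<in> space M" using elim unfolding free_part_def by blast
    then have "(x, x) \<in> T" using T_equiv unfolding equiv_def by (meson refl_onD)
    then have "\<one> \<in> returns T (carrier G) x" using x unfolding returns_def by simp
    then have "card (returns T (carrier G) x) \<noteq> 0"
      using finite_returns_free[OF elim] by auto
    then show ?case unfolding return_ratio_def by simp
  qed
  then have "return_mean T (carrier G) = integral\<^sup>L M (\<lambda>_. 1)"
    unfolding return_mean_def using integrable_return_ratio[of "carrier G"] by (intro integral_cong_AE) auto
  then show ?thesis by (simp add: prob_space)
qed

lemma return_mean_le_1:
  assumes "S \<subseteq> carrier G"
  shows "return_mean T S \<le> 1"
proof -
  have "AE x in M. return_ratio T S x \<le> 1"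
    using AE_free_part by eventually_elim (use return_ratio_le_1 assms in auto)
  then have "return_mean T S \<le> integral\<^sup>L M (\<lambda>_. 1)"
    unfolding return_mean_def using integrable_return_ratio[OF assms] by (intro integral_mono_AE) auto
  then show ?thesis by (simp add: prob_space)
qed

lemma return_mean_Un:
  assumes S: "S \<subseteq> carrier G" "S' \<subseteq> carrier G" "S \<inter> S' = {}"
  shows "return_mean T (S \<union> S') = return_mean T S + return_mean T S'"
proof -
  have "AE x in M. return_ratio T (S \<union> S') x = return_ratio T S x + return_ratio T S' x"
    using AE_free_part
  proof eventually_elim
    case (elim x)
    have "returns T (S \<union> S') x = returns T S x \<union> returns T S' x"
      unfolding returns_def by auto
    moreover have "returns T S x \<inter> returns T S' x = {}" using S(3) unfolding returns_def by auto
    ultimately have "card (returns T (S \<union> S') x) = card (returns T S x) + card (returns T S' x)"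
      using finite_returns_free elim S by (simp add: card_Un_disjoint)
    then show ?case unfolding return_ratio_def by (simp add: add_divide_distrib)
  qed
  then have "return_mean T (S \<union> S') = integral\<^sup>L M (\<lambda>x. return_ratio T S x + return_ratio T S' x)"
    unfolding return_mean_def
    using integrable_return_ratio[of S] integrable_return_ratio[of S'] integrable_return_ratio[of "S \<union> S'"] S
    by (intro integral_cong_AE) auto
  then show ?thesis
    unfolding return_mean_def using integrable_return_ratio S by simp
qed

text \<open>The two ratios agree wherever \<open>x\<close> and \<open>\<phi> (inv g) x\<close> are related by \<open>T\<close>, and they differ by at most 1
  elsewhere.\<close>

lemma return_mean_almost_invariant:
  assumes g: "g \<in> carrier G" and S: "S \<subseteq> carrier G"
  shows "\<bar>return_mean T (g <# S) - return_mean T S\<bar> \<le> measure M {x \<in> space M. (x, \<phi> (inv g) x) \<notin> T}"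
proof -
  let ?B = "{x \<in> space M. (x, \<phi> (inv g) x) \<notin> T}"
  have ig: "inv g \<in> carrier G" using g by simp
  have gS: "g <# S \<subseteq> carrier G" by (rule l_coset_subset_G[OF S g])
  have "?B = space M - {x \<in> space M. (x, \<phi> (inv g) x) \<in> T}" by blast
  then have B: "?B \<in> sets M" using sets_in_rel1[OF T_sets ig] by simp
  let ?q = "return_ratio T (g <# S)" and ?r = "\<lambda>x. return_ratio T S (\<phi> (inv g) x)"
  have q: "integrable M ?q" using integrable_return_ratio gS .
  have "integrable (distr M M (\<phi> (inv g))) (return_ratio T S)"
    using integrable_return_ratio[OF S] distr_act[OF ig] by simp
  then have r: "integrable M ?r" by (rule integrable_distr[OF act_measurable[OF ig]])
  have "return_mean T S = integral\<^sup>L (distr M M (\<phi> (inv g))) (return_ratio T S)"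
    unfolding return_mean_def distr_act[OF ig] ..
  also have "\<dots> = integral\<^sup>L M ?r"
    using integrable_return_ratio[OF S] by (intro integral_distr act_measurable ig) auto
  finally have "return_mean T (g <# S) - return_mean T S = integral\<^sup>L M (\<lambda>x. ?q x - ?r x)"
    unfolding return_mean_def using q r by simp
  also have "\<bar>\<dots>\<bar> \<le> integral\<^sup>L M (\<lambda>x. \<bar>?q x - ?r x\<bar>)" by (rule integral_abs_bound)
  also have "\<dots> \<le> integral\<^sup>L M (indicator ?B)"
  proof (rule integral_mono_AE)
    show "integrable M (indicator ?B :: 'x \<Rightarrow> real)"
      using B by (simp add: integrable_indicator_iff emeasure_eq_measure)
    show "AE x in M. \<bar>?q x - ?r x\<bar> \<le> indicator ?B x"
      using AE_free_part AE_act[OF ig AE_free_part] AE_space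
    proof eventually_elim
      case (elim x)
      show ?case
      proof (cases "x \<in> ?B")
        case True
        then show ?thesis
          using return_ratio_nonneg[of "g <# S" x] return_ratio_nonneg[of S "\<phi> (inv g) x"]
            return_ratio_le_1[OF elim(1) gS] return_ratio_le_1[OF elim(2) S] by (simp add: abs_le_iff)
      next
        case False
        then have "(x, \<phi> (inv g) x) \<in> T" using elim by blast
        then show ?thesis using return_ratio_translate[OF T_equiv g S] False by simp
      qed
    qed
  qed (use q r in auto)
  also have "\<dots> = measure M ?B" using B by simp
  finally show ?thesis .
qed

end

text \<open>Averaging the uniform distributions on the finite classes of \<open>T n\<close> gives finitely additive probabilities on the group
  that are invariant up to the measure of the points moved out of their class, which tends to 0. By Tychonoff's theorem
  they have a cluster point, and it is an invariant mean.\<close>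

theorem amenable_if_orbits_in_hyperfinite:
  assumes inc: "incseq T" and T_sets: "\<And>n. T n \<in> sets (M \<Otimes>\<^sub>M M)"
    and T_equiv: "\<And>n. equiv (space M) (T n)"
    and T_fin: "\<And>n x. x \<in> space M \<Longrightarrow> finite (T n `` {x})"
    and exhaust: "\<And>g. g \<in> carrier G \<Longrightarrow> AE x in M. \<exists>n. (x, \<phi> g x) \<in> T n"
  shows "amenable G"
proof -
  \<comment> \<open>Outside the subsets of the group the value is irrelevant; 0 keeps it in the compact box.\<close>
  define \<mu> where "\<mu> n S = (if S \<subseteq> carrier G then return_mean (T n) S else 0)" for n S
  note ctxt = T_sets T_equiv T_fin
  define Box where "Box = PiE UNIV (\<lambda>S :: 'a set. {0..1 :: real})"
  have "compact Box"
  proof -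
    have "compactin (product_topology (\<lambda>_. euclidean) UNIV) Box"
      unfolding Box_def by (subst compactin_PiE) auto
    then show ?thesis by (simp add: euclidean_product_topology)
  qed
  moreover have "\<mu> n \<in> Box" for n
    unfolding Box_def \<mu>_def using return_mean_nonneg[OF ctxt] return_mean_le_1[OF ctxt] by auto
  ultimately obtain m where m: "m \<in> Box" "inf (nhds m) (filtermap \<mu> sequentially) \<noteq> bot"
    unfolding compact_filter by (metis (no_types, lifting) always_eventually eventually_filtermap filtermap_bot_iff sequentially_bot)
  define F where "F = inf (nhds m) (filtermap \<mu> sequentially)"
  have F: "F \<noteq> bot" using m(2) unfolding F_def .
  have eval: "((\<lambda>f. f S) \<longlongrightarrow> m S) F" for S :: "'a set"
  proof -
    have "(\<lambda>f :: 'a set \<Rightarrow> real. f S) \<midarrow>m\<rightarrow> m S"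
      using continuous_on_product_coordinates[of S] unfolding continuous_on_def by blast
    then have "((\<lambda>f :: 'a set \<Rightarrow> real. f S) \<longlongrightarrow> m S) (nhds m)"
      using tendsto_at_iff_tendsto_nhds[of "\<lambda>f :: 'a set \<Rightarrow> real. f S" m] by simp
    then show ?thesis unfolding F_def by (rule tendsto_mono[rotated]) simp
  qed
  have along: "(h \<longlongrightarrow> l) F" if "(\<lambda>n. h (\<mu> n)) \<longlonglongrightarrow> l" for h :: "('a set \<Rightarrow> real) \<Rightarrow> real" and l
  proof -
    have "(h \<longlongrightarrow> l) (filtermap \<mu> sequentially)" using that by (simp add: filterlim_filtermap)
    then show ?thesis unfolding F_def by (rule tendsto_mono[rotated]) simp
  qed
  show ?thesis
    unfolding amenable_def
  proof (intro exI[of _ m] conjI allI impI ballI)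
    show "0 \<le> m S" for S using m(1) unfolding Box_def by auto
    have "(\<lambda>n. \<mu> n (carrier G)) \<longlonglongrightarrow> 1"
      unfolding \<mu>_def using return_mean_carrier[OF ctxt] by simp
    then show "m (carrier G) = 1" using along[of "\<lambda>f. f (carrier G)"] eval F tendsto_unique by blast
  next
    fix S S' assume S: "S \<subseteq> carrier G" "S' \<subseteq> carrier G" "S \<inter> S' = {}"
    have "((\<lambda>f. f (S \<union> S') - (f S + f S')) \<longlongrightarrow> 0) F"
      by (rule along) (use S return_mean_Un[OF ctxt] in \<open>simp add: \<mu>_def\<close>)
    moreover have "((\<lambda>f. f (S \<union> S') - (f S + f S')) \<longlongrightarrow> m (S \<union> S') - (m S + m S')) F"
      by (intro tendsto_intros eval)
    ultimately show "m (S \<union> S') = m S + m S'" using tendsto_unique[OF F] by fastforce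
  next
    fix g S assume g: "g \<in> carrier G" and S: "S \<subseteq> carrier G"
    have gS: "g <# S \<subseteq> carrier G" by (rule l_coset_subset_G[OF S g])
    have ig: "inv g \<in> carrier G" using g by simp
    let ?B = "\<lambda>n. {x \<in> space M. (x, \<phi> (inv g) x) \<notin> T n}"
    have B: "?B n \<in> sets M" for n
    proof -
      have "?B n = space M - {x \<in> space M. (x, \<phi> (inv g) x) \<in> T n}" by blast
      then show ?thesis using sets_in_rel1[OF T_sets ig] by simp
    qed
    have "(\<lambda>n. measure M (?B n)) \<longlonglongrightarrow> measure M (\<Inter>n. ?B n)"
    proof (rule finite_Lim_measure_decseq)
      show "decseq ?B" using inc unfolding decseq_def incseq_def by blast
    qed (use B in auto)
    moreover have "(\<Inter>n. ?B n) \<in> null_sets M"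
      using exhaust[OF ig] B by (subst AE_iff_null_sets) (auto elim: eventually_mono)
    ultimately have lim: "(\<lambda>n. measure M (?B n)) \<longlonglongrightarrow> 0"
      by (simp add: null_sets_def measure_def)
    have "(\<lambda>n. \<mu> n (g <# S) - \<mu> n S) \<longlonglongrightarrow> 0"
    proof (rule Lim_null_comparison[OF _ lim])
      show "\<forall>\<^sub>F n in sequentially. norm (\<mu> n (g <# S) - \<mu> n S) \<le> measure M (?B n)"
        using return_mean_almost_invariant[OF ctxt g S] S gS by (simp add: \<mu>_def)
    qed
    then have "((\<lambda>f. f (g <# S) - f S) \<longlongrightarrow> 0) F" by (rule along)
    moreover have "((\<lambda>f. f (g <# S) - f S) \<longlongrightarrow> m (g <# S) - m S) F"
      by (intro tendsto_intros eval)
    ultimately show "m (g <# S) = m S" using tendsto_unique[OF F] by fastforce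
  qed
qed

end

section \<open>Actions of product groups have higher rank\<close>

text \<open>Covers both kinds of action needed below: the restriction to a subgroup, with the identity as \<open>h\<close>, and the action of one
  factor of a product.\<close>

lemma (in free_countable_pmp_action) pullback:
  assumes H: "group H" "countable (carrier H)" and h: "h \<in> hom H G" "inj_on h (carrier H)"
  shows "free_countable_pmp_action H M (\<phi> \<circ> h)"
proof -
  have carrier: "h b \<in> carrier G" if "b \<in> carrier H" for b using h(1) that by (rule hom_in_carrier)
  have one: "h \<one>\<^bsub>H\<^esub> = \<one>"
    using hom_one[OF h(1) H(1)] is_group by simp
  have act: "\<phi> \<in> hom G (BijGroup (space M))" and bij: "group (BijGroup (space M))"
    using action.group_hom unfolding group_hom_def group_hom_axioms_def by auto
  have "\<phi> \<circ> h \<in> hom H (BijGroup (space M))" using h(1) act by (rule Group.hom_compose)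
  then have "group_action H (space M) (\<phi> \<circ> h)"
    using H(1) bij by (intro group_action.intro group_hom.intro group_hom_axioms.intro)
  then have "pmp_action H M (\<phi> \<circ> h)"
    unfolding pmp_action_def using carrier distr_act act_measurable prob_space_axioms by auto
  moreover have "essentially_free H M (\<phi> \<circ> h)"
    unfolding essentially_free_def using AE_free_part
  proof eventually_elim
    case (elim x)
    have x: "x \<in> space M" using elim unfolding free_part_def by blast
    have only_one: "b = \<one>\<^bsub>H\<^esub>" if "b \<in> carrier H" "\<phi> (h b) x = x" for b
    proof (rule inj_onD[OF h(2)])
      show "h b = h \<one>\<^bsub>H\<^esub>" using elim that carrier one unfolding free_part_def by auto
    qed (use that group.is_monoid[OF H(1)] monoid.one_closed in auto)
    have "\<one>\<^bsub>H\<^esub> \<in> carrier H" using group.is_monoid[OF H(1)] by (rule monoid.one_closed)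
    moreover have "(\<phi> \<circ> h) \<one>\<^bsub>H\<^esub> x = x" using x by (simp add: one)
    ultimately show ?case
      unfolding stabilizer_def
      by (intro equalityI subsetI) (auto dest: only_one)
  qed
  ultimately show ?thesis
    using H(2) separated
    by (intro free_countable_pmp_action.intro countable_pmp_action.intro
        free_countable_pmp_action_axioms.intro)
qed

lemma rel_measure_mono: "F \<subseteq> F' \<Longrightarrow> rel_measure M F \<le> rel_measure M F'"
  unfolding rel_measure_def by (intro nn_integral_mono emeasure_mono) auto

lemma subset_mod_null_mono: "S \<subseteq> S' \<Longrightarrow> subset_mod_null M S' T \<Longrightarrow> subset_mod_null M S T"
  unfolding subset_mod_null_def using rel_measure_mono[of "S - T" "S' - T" M]
  by (metis Diff_mono bot.extremum_uniqueI bot_ennreal order_refl)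

lemma (in countable_pmp_action) AE_in_rel_if_subset_mod_null:
  assumes S: "S \<in> sets (M \<Otimes>\<^sub>M M)" "S \<subseteq> orbit_rel G M \<phi>" and T: "T \<in> sets (M \<Otimes>\<^sub>M M)"
    and sub: "subset_mod_null M S T" and g: "g \<in> carrier G"
  shows "AE x in M. (x, \<phi> g x) \<in> S \<longrightarrow> (x, \<phi> g x) \<in> T"
proof -
  have "rel_measure M (S - T) = 0" using sub unfolding subset_mod_null_def .
  moreover have "S - T \<in> sets (M \<Otimes>\<^sub>M M)" "S - T \<subseteq> orbit_rel G M \<phi>" using S T by auto
  ultimately have "AE x in M. (x, \<phi> g x) \<notin> S - T" using rel_measure_eq_0_iff g by blast
  then show ?thesis by eventually_elim blast
qed

theorem corollary4p7:
  fixes A :: "('a, 'm) monoid_scheme"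
    and B :: "('b, 'n) monoid_scheme"
    and M :: "'x measure"
    and \<phi> :: "'a \<times> 'b \<Rightarrow> 'x \<Rightarrow> 'x"
    and A' :: "'a set"
  assumes "group A" "countable (carrier A)" "infinite (carrier A)"
    and "group B" "countable (carrier B)" "infinite (carrier B)"
    and "standard_prob_space M"
    and "pmp_action (A \<times>\<times> B) M \<phi>"
    and "essentially_free (A \<times>\<times> B) M \<phi>"
    and "ergodic_action (A \<times>\<times> B) M \<phi>"
    and "\<not> amenable B"
    and "subgroup A' A" "infinite A'" "amenable (A\<lparr>carrier := A'\<rparr>)"
  shows "higher_rank M (orbit_rel (A \<times>\<times> B) M \<phi>)"
  unfolding higher_rank_def
proof
  let ?G = "A \<times>\<times> B"
  let ?R = "orbit_rel ?G M \<phi>"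
  assume rank_one: "rank_one M ?R"
  interpret A: group A by fact
  interpret B: group B by fact
  have "countably_separated M"
    using assms(7) standard_borel_imp_countably_separated unfolding standard_prob_space_def by blast
  then interpret G: free_countable_pmp_action ?G M \<phi>
    using assms(2,5,8,9)
    by (intro free_countable_pmp_action.intro countable_pmp_action.intro
        free_countable_pmp_action_axioms.intro) auto
  \<comment> \<open>The trivial element gives the action of \<open>A'\<close> alone, so \<open>S \<one>\<close> is contained in every \<open>S b\<close>.\<close>
  define H where "H b = A\<lparr>carrier := A'\<rparr> \<times>\<times> B\<lparr>carrier := generate B {b}\<rparr>" for b
  define S where "S b = orbit_rel (H b) M \<phi>" for b
  have A'_group: "group (A\<lparr>carrier := A'\<rparr>)"
    using assms(12) by (rule subgroup.subgroup_is_group) (rule A.is_group)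
  have S: "subequiv_rel M ?R (S b)" "aperiodic M (S b)" "hyperfinite M (S b)"
    if b: "b \<in> carrier B" for b
  proof -
    have gen: "subgroup (generate B {b}) B" using b B.generate_is_subgroup[of "{b}"] by simp
    have gen_group: "group (B\<lparr>carrier := generate B {b}\<rparr>)"
      using gen by (rule subgroup.subgroup_is_group) (rule B.is_group)
    have carrier: "carrier (H b) = A' \<times> generate B {b}" unfolding H_def by simp
    have sub: "carrier (H b) \<subseteq> carrier ?G"
      unfolding carrier using subgroup.subset[OF assms(12)] subgroup.subset[OF gen] by auto
    have "group (H b)" unfolding H_def using A'_group gen_group by (rule DirProd_group)
    moreover have "countable (carrier (H b))"
      using sub G.countable_group by (rule countable_subset)
    moreover have "id \<in> hom (H b) ?G"
      using sub unfolding hom_def H_def by auto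
    ultimately have "free_countable_pmp_action (H b) M (\<phi> \<circ> id)"
      by (intro G.pullback) auto
    then interpret H: free_countable_pmp_action "H b" M \<phi> by simp
    have "S b \<subseteq> ?R" unfolding S_def orbit_rel_def using sub by blast
    then show "subequiv_rel M ?R (S b)"
      using H.subequiv_rel_orbit_rel unfolding subequiv_rel_def S_def by blast
    have "generate B {b} \<noteq> {}" using subgroup.one_closed[OF gen] by blast
    then have "infinite (carrier (H b))"
      unfolding carrier using assms(13) finite_cartesian_productD1 by blast
    then show "aperiodic M (S b)" unfolding S_def by (rule H.aperiodic_orbit_rel)
    have "folner (H b)"
      unfolding H_def using group.amenable_imp_folner[OF A'_group assms(14)] B.folner_cyclic[OF b]
      by (rule folner_DirProd)
    then show "hyperfinite M (S b)" unfolding S_def by (rule H.hyperfinite_orbit_rel)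
  qed
  have S_sub: "S \<one>\<^bsub>B\<^esub> \<subseteq> S b" if b: "b \<in> carrier B" for b
  proof -
    have "generate B {\<one>\<^bsub>B\<^esub>} \<subseteq> generate B {b}"
      using B.generate_one B.generate_is_subgroup[of "{b}"] b by (auto intro: subgroup.one_closed)
    then show ?thesis unfolding S_def H_def orbit_rel_def by auto
  qed
  have unique: "\<exists>T. maximal_hyperfinite M ?R T \<and> subset_mod_null M (S b) T \<and>
      (\<forall>T'. maximal_hyperfinite M ?R T' \<longrightarrow> subset_mod_null M (S b) T' \<longrightarrow> eq_mod_null M T T')"
    if "b \<in> carrier B" for b
    using rank_one S[OF that] unfolding rank_one_def by blast
  obtain T where T: "maximal_hyperfinite M ?R T"
    and T_unique: "\<And>T'. maximal_hyperfinite M ?R T' \<Longrightarrow> subset_mod_null M (S \<one>\<^bsub>B\<^esub>) T' \<Longrightarrow> eq_mod_null M T T'"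
    using unique[OF B.one_closed] by blast
  have T_sub: "subequiv_rel M ?R T" and T_hyp: "hyperfinite M T"
    using T unfolding maximal_hyperfinite_def by auto
  have T_sets: "T \<in> sets (M \<Otimes>\<^sub>M M)" "T \<subseteq> ?R" using T_sub unfolding subequiv_rel_def by auto
  have in_T: "AE x in M. (x, \<phi> (\<one>\<^bsub>A\<^esub>, b) x) \<in> T" if b: "b \<in> carrier B" for b
  proof -
    let ?g = "(\<one>\<^bsub>A\<^esub>, b)"
    have g: "?g \<in> carrier ?G" using b by simp
    obtain T' where T': "maximal_hyperfinite M ?R T'" "subset_mod_null M (S b) T'"
      using unique[OF b] by blast
    have T'_sets: "T' \<in> sets (M \<Otimes>\<^sub>M M)" "T' \<subseteq> ?R"
      using T'(1) unfolding maximal_hyperfinite_def subequiv_rel_def by auto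
    have "eq_mod_null M T T'"
      using T_unique T'(1) subset_mod_null_mono[OF S_sub[OF b] T'(2)] by blast
    then have "subset_mod_null M T' T"
      using rel_measure_mono[of "T' - T" "(T - T') \<union> (T' - T)" M]
      unfolding eq_mod_null_def subset_mod_null_def by auto
    then have "AE x in M. (x, \<phi> ?g x) \<in> T' \<longrightarrow> (x, \<phi> ?g x) \<in> T"
      using T'_sets T_sets g by (intro G.AE_in_rel_if_subset_mod_null)
    moreover have "AE x in M. (x, \<phi> ?g x) \<in> S b \<longrightarrow> (x, \<phi> ?g x) \<in> T'"
      using S(1)[OF b] T'(2) T'_sets(1) g unfolding subequiv_rel_def
      by (intro G.AE_in_rel_if_subset_mod_null) auto
    moreover have "AE x in M. (x, \<phi> ?g x) \<in> S b"
    proof (rule AE_I2)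
      fix x assume "x \<in> space M"
      moreover have "?g \<in> carrier (H b)"
        unfolding H_def using subgroup.one_closed[OF assms(12)] generate.incl[of b "{b}" B] by simp
      ultimately show "(x, \<phi> ?g x) \<in> S b" unfolding S_def orbit_rel_def by blast
    qed
    ultimately show ?thesis by eventually_elim blast
  qed
  obtain U where U: "incseq U" "\<And>n. subequiv_rel M T (U n)" "\<And>n x. x \<in> space M \<Longrightarrow> finite (U n `` {x})"
    and U_null: "eq_mod_null M T (\<Union>n. U n)"
    using T_hyp unfolding hyperfinite_def by blast
  have U_sets: "U n \<in> sets (M \<Otimes>\<^sub>M M)" "equiv (space M) (U n)" for n
    using U(2)[of n] unfolding subequiv_rel_def by auto
  have "subset_mod_null M T (\<Union>n. U n)"
    using U_null rel_measure_mono[of "T - (\<Union>n. U n)" "(T - (\<Union>n. U n)) \<union> ((\<Union>n. U n) - T)" M]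
    unfolding eq_mod_null_def subset_mod_null_def by auto
  then have in_U: "AE x in M. (x, \<phi> (\<one>\<^bsub>A\<^esub>, b) x) \<in> T \<longrightarrow> (x, \<phi> (\<one>\<^bsub>A\<^esub>, b) x) \<in> (\<Union>n. U n)"
    if "b \<in> carrier B" for b
    using T_sets U_sets that by (intro G.AE_in_rel_if_subset_mod_null) auto
  have "(\<lambda>b. (\<one>\<^bsub>A\<^esub>, b)) \<in> hom B ?G" unfolding hom_def by auto
  then interpret B': free_countable_pmp_action B M "\<phi> \<circ> (\<lambda>b. (\<one>\<^bsub>A\<^esub>, b))"
    using assms(5) B.is_group by (intro G.pullback) (auto intro: inj_onI)
  have "amenable B"
  proof (rule B'.amenable_if_orbits_in_hyperfinite[OF U(1) U_sets U(3)])
    fix b assume b: "b \<in> carrier B"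
    show "AE x in M. \<exists>n. (x, (\<phi> \<circ> (\<lambda>b. (\<one>\<^bsub>A\<^esub>, b))) b x) \<in> U n"
      using in_T[OF b] in_U[OF b] by eventually_elim auto
  qed
  then show False using \<open>\<not> amenable B\<close> by blast
qed

end
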